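(* Let $f$ and $g$ be Möbius transformations such that $\mathrm{tr}(f)\leq\mathrm{tr}(g)$ and the semigroup $\langle f,g\rangle$ is nonelementary. Then $\langle f,g\rangle$ is semidiscrete if and only if one of the following holds: (i) $\langle f,g\rangle$ is semidiscrete and inverse free; (ii) $\langle f,g\rangle$ is a Fuchsian group; (iii) $f$ is elliptic of finite order, and $f^ng$ is not elliptic for $n=0,1,\dots,\mathrm{ord}(f)-1$.
   Context: $\mathbb{H}$ is the upper half-plane, $\overline{\mathbb{R}}=\mathbb{R}\cup\{\infty\}$, $\overline{\mathbb{H}}=\mathbb{H}\cup\overline{\mathbb{R}}$. "Möbius transformation" means $z\mapsto (az+b)/(cz+d)$ with $a,b,c,d\in\mathbb{R}$, $ad-bc>0$; these form the topological group $\mathcal{M}\cong\mathrm{PSL}(2,\mathbb{R})$ with identity $I$. A semigroup is a nonempty subset of $\mathcal{M}$ closed under composition; $\langle f,g\rangle$ denotes the semigroup (not the group) generated by $f$ and $g$. A semigroup $S$ is semidiscrete if $I$ is not an accumulation point of $S$ in $\mathcal{M}$, and inverse free if $I\notin S$. $S$ is elementary if it has a finite orbit in its action on $\overline{\mathbb{H}}$, and nonelementary otherwise. If $f(z)=(az+b)/(cz+d)$ with $ad-bc=1$, then $\mathrm{tr}(f)=|a+d|$. $\mathrm{ord}(f)$ is the order of an elliptic transformation $f$ of finite order. A Fuchsian group is a discrete subgroup of $\mathcal{M}$. *)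

theory Defs
  imports "HOL-Analysis.Analysis" "HOL-Algebra.Multiplicative_Group"
begin

section \<open>Moebius transformations\<close>

text \<open>The Riemann sphere is \<open>complex option\<close>, with \<open>None\<close> for the point at infinity.\<close>

type_synonym sphere = "complex option"

definition upper_half_plane :: "sphere set" where
  "upper_half_plane = {Some z | z. Im z > 0}"

definition closed_upper_half_plane :: "sphere set" where
  "closed_upper_half_plane =
     upper_half_plane \<union> {Some z | z. Im z = 0} \<union> {None}"

fun moebius :: "real^2^2 \<Rightarrow> sphere \<Rightarrow> sphere" where
  "moebius A (Some z) =
     (if of_real (A$2$1) * z + of_real (A$2$2) = 0 then None
      else Some ((of_real (A$1$1) * z + of_real (A$1$2)) / (of_real (A$2$1) * z + of_real (A$2$2))))"
| "moebius A None =
     (if A$2$1 = 0 then None else Some (of_real (A$1$1) / of_real (A$2$1)))"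

definition moebius_group :: "(sphere \<Rightarrow> sphere) monoid" where
  "moebius_group = \<lparr>carrier = moebius ` {A. det A > 0}, monoid.mult = (\<circ>), one = id\<rparr>"

definition SL2 :: "(real^2^2) set" where
  "SL2 = {A. det A = 1}"

text \<open>The quotient topology of \<open>SL(2,\<real>)\<close>, that is, the topology of \<open>PSL(2,\<real>)\<close>;
  see \<open>quotient_map_moebius\<close> below.\<close>

definition moebius_topology :: "(sphere \<Rightarrow> sphere) topology" where
  "moebius_topology = topology (\<lambda>U. U \<subseteq> carrier moebius_group \<and>
     openin (top_of_set SL2) {A \<in> SL2. moebius A \<in> U})"

text \<open>The normalised matrix of a transformation is unique up to sign
  (\<open>moebius_eq_imp\<close> below), so the description picks out a unique number.\<close>

definition moebius_tr :: "(sphere \<Rightarrow> sphere) \<Rightarrow> real" where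
  "moebius_tr f = (THE t. \<exists>A. det A = 1 \<and> f = moebius A \<and> t = \<bar>trace A\<bar>)"

definition elliptic :: "(sphere \<Rightarrow> sphere) \<Rightarrow> bool" where
  "elliptic f \<longleftrightarrow> f \<in> carrier moebius_group \<and> f \<noteq> \<one>\<^bsub>moebius_group\<^esub> \<and>
     (\<exists>z\<in>upper_half_plane. f z = z)"

definition finite_order :: "(sphere \<Rightarrow> sphere) \<Rightarrow> bool" where
  "finite_order f \<longleftrightarrow> (\<exists>n::nat. n > 0 \<and> f [^]\<^bsub>moebius_group\<^esub> n = \<one>\<^bsub>moebius_group\<^esub>)"


section \<open>Semigroups of Moebius transformations\<close>

inductive_set semigroup_generated ::
    "(sphere \<Rightarrow> sphere) set \<Rightarrow> (sphere \<Rightarrow> sphere) set" for X where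
  gen: "f \<in> X \<Longrightarrow> f \<in> semigroup_generated X"
| mult: "f \<in> semigroup_generated X \<Longrightarrow> g \<in> semigroup_generated X \<Longrightarrow>
    f \<otimes>\<^bsub>moebius_group\<^esub> g \<in> semigroup_generated X"

definition semidiscrete :: "(sphere \<Rightarrow> sphere) set \<Rightarrow> bool" where
  "semidiscrete S \<longleftrightarrow> \<one>\<^bsub>moebius_group\<^esub> \<notin> moebius_topology derived_set_of S"

definition inverse_free :: "(sphere \<Rightarrow> sphere) set \<Rightarrow> bool" where
  "inverse_free S \<longleftrightarrow> \<one>\<^bsub>moebius_group\<^esub> \<notin> S"

definition semigroup_orbit :: "(sphere \<Rightarrow> sphere) set \<Rightarrow> sphere \<Rightarrow> sphere set" where
  "semigroup_orbit S z = {h z | h. h \<in> S}"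

definition elementary :: "(sphere \<Rightarrow> sphere) set \<Rightarrow> bool" where
  "elementary S \<longleftrightarrow> (\<exists>z\<in>closed_upper_half_plane. finite (semigroup_orbit S z))"

definition fuchsian_group :: "(sphere \<Rightarrow> sphere) set \<Rightarrow> bool" where
  "fuchsian_group S \<longleftrightarrow> subgroup S moebius_group \<and>
     subtopology moebius_topology S = discrete_topology S"


section \<open>Well-definedness\<close>

lemma moebius_mat1: "moebius (mat 1) = id"
proof
  fix z show "moebius (mat 1) z = id z"
    by (cases z) (auto simp: mat_def)
qed

lemma moebius_num_nonzero:
  fixes A :: "real^2^2" and z :: complex
  assumes "det A \<noteq> 0" "of_real (A$2$1) * z + of_real (A$2$2) = 0"
  shows "of_real (A$1$1) * z + of_real (A$1$2) \<noteq> 0"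
proof
  assume *: "of_real (A$1$1) * z + of_real (A$1$2) = 0"
  have "of_real (det A) * z = of_real (A$2$2) * (of_real (A$1$1) * z + of_real (A$1$2)) -
      of_real (A$1$2) * (of_real (A$2$1) * z + of_real (A$2$2))"
    by (simp add: det_2 algebra_simps)
  hence "z = 0" using * assms by auto
  thus False using * assms by (simp add: det_2)
qed

lemma matrix_mult_2:
  fixes A B :: "real^2^2"
  shows "(A ** B)$i$j = A$i$1 * B$1$j + A$i$2 * B$2$j"
  by (simp add: matrix_matrix_mult_def sum_2)

lemma moebius_homogeneous:
  assumes "p \<noteq> 0 \<or> q \<noteq> 0"
  shows "moebius A (if q = 0 then None else Some (p / q)) =
    (if of_real (A$2$1) * p + of_real (A$2$2) * q = 0 then None
     else Some ((of_real (A$1$1) * p + of_real (A$1$2) * q) / (of_real (A$2$1) * p + of_real (A$2$2) * q)))"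
proof (cases "q = 0")
  case True
  thus ?thesis using assms by simp
next
  case False
  have "of_real (A$i$1) * (p / q) + of_real (A$i$2) = (of_real (A$i$1) * p + of_real (A$i$2) * q) / q" for i
    using False by (simp add: field_simps)
  thus ?thesis using False by simp
qed

lemma moebius_compose:
  assumes "det A \<noteq> 0" "det B \<noteq> 0"
  shows "moebius A \<circ> moebius B = moebius (A ** B)"
proof
  fix z
  show "(moebius A \<circ> moebius B) z = moebius (A ** B) z"
  proof (cases z)
    case None
    have "complex_of_real (B$1$1) \<noteq> 0 \<or> complex_of_real (B$2$1) \<noteq> 0"
      using assms(2) by (auto simp: det_2)
    from moebius_homogeneous[OF this, of A] show ?thesis
      by (simp add: None matrix_mult_2 flip: of_real_mult of_real_add)
  next
    case (Some w)
    define p q where "p = of_real (B$1$1) * w + of_real (B$1$2)"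
      and "q = of_real (B$2$1) * w + of_real (B$2$2)"
    have "of_real ((A ** B)$i$1) * w + of_real ((A ** B)$i$2) =
        of_real (A$i$1) * p + of_real (A$i$2) * q" for i
      by (simp add: matrix_mult_2 p_def q_def algebra_simps)
    moreover have "moebius B z = (if q = 0 then None else Some (p / q))"
      by (simp add: Some p_def q_def)
    moreover have "p \<noteq> 0 \<or> q \<noteq> 0"
      using moebius_num_nonzero[OF assms(2), of w] by (auto simp: p_def q_def)
    ultimately show ?thesis
      by (simp only: o_apply moebius_homogeneous) (simp add: Some)
  qed
qed

lemma moebius_scaleR:
  assumes "r \<noteq> 0"
  shows "moebius (r *\<^sub>R A) = moebius A"
proof
  fix z
  have "of_real (r * x) * w + of_real (r * y) = of_real r * (of_real x * w + of_real y)"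
    for x y and w :: complex
    by (simp add: algebra_simps)
  thus "moebius (r *\<^sub>R A) z = moebius A z"
    using assms by (cases z) (simp_all del: of_real_mult, simp)
qed

lemma det_2_scaleR: "det (r *\<^sub>R (A::real^2^2)) = r\<^sup>2 * det A"
  by (simp add: det_2 power2_eq_square algebra_simps)

lemma carrier_moebius_group: "carrier moebius_group = moebius ` SL2"
proof
  show "moebius ` SL2 \<subseteq> carrier moebius_group"
    by (auto simp: moebius_group_def SL2_def)
  show "carrier moebius_group \<subseteq> moebius ` SL2"
  proof
    fix f assume "f \<in> carrier moebius_group"
    then obtain A where A: "f = moebius A" "det A > 0"
      by (auto simp: moebius_group_def)
    define r where "r = 1 / sqrt (det A)"
    have "r \<noteq> 0" "r\<^sup>2 * det A = 1" using A(2) by (auto simp: r_def power_divide)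
    hence "r *\<^sub>R A \<in> SL2" "f = moebius (r *\<^sub>R A)"
      using A(1) by (auto simp: SL2_def det_2_scaleR moebius_scaleR)
    thus "f \<in> moebius ` SL2" by blast
  qed
qed

lemma group_moebius_group: "group moebius_group"
proof (rule groupI)
  show "\<one>\<^bsub>moebius_group\<^esub> \<in> carrier moebius_group"
    using moebius_mat1[symmetric] by (auto simp: moebius_group_def intro!: image_eqI[of _ _ "mat 1"])
next
  fix f g assume "f \<in> carrier moebius_group" "g \<in> carrier moebius_group"
  then obtain A B where AB: "f = moebius A" "g = moebius B" "det A > 0" "det B > 0"
    by (auto simp: moebius_group_def)
  have "f \<circ> g = moebius (A ** B)" using moebius_compose[of A B] AB by simp
  moreover have "det (A ** B) > 0" using AB by (simp add: det_mul)
  ultimately show "f \<otimes>\<^bsub>moebius_group\<^esub> g \<in> carrier moebius_group"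
    by (auto simp: moebius_group_def)
next
  fix f assume "f \<in> carrier moebius_group"
  then obtain A where A: "f = moebius A" "det A > 0"
    by (auto simp: moebius_group_def)
  have "invertible A" using A(2) by (simp add: invertible_det_nz)
  then obtain B where B: "B ** A = mat 1" by (auto simp: invertible_def)
  hence "det B * det A = 1" by (metis det_I det_mul)
  hence "det B > 0" using A(2) by (metis zero_less_mult_pos2 zero_less_one)
  moreover have "moebius B \<circ> f = id"
    using moebius_compose[of B A] A B \<open>det B > 0\<close> by (simp add: moebius_mat1)
  ultimately show "\<exists>g\<in>carrier moebius_group. g \<otimes>\<^bsub>moebius_group\<^esub> f = \<one>\<^bsub>moebius_group\<^esub>"
    by (auto simp: moebius_group_def)
qed (auto simp: moebius_group_def)

lemma moebius_eq_id_imp: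
  assumes "det A = 1" "moebius A = id"
  shows "A = mat 1 \<or> A = - mat 1"
proof -
  have c: "A$2$1 = 0" using fun_cong[OF assms(2), of None] by (auto split: if_splits)
  hence d: "A$1$1 * A$2$2 = 1" using assms(1) by (simp add: det_2)
  hence "A$2$2 \<noteq> 0" by auto
  moreover from this have b: "A$1$2 = 0"
    using fun_cong[OF assms(2), of "Some 0"] c by (auto split: if_splits)
  ultimately have "A$1$1 = A$2$2"
    using fun_cong[OF assms(2), of "Some 1"] c by (auto split: if_splits)
  with d have "A$1$1 = 1 \<or> A$1$1 = -1" by (simp add: square_eq_1_iff)
  thus ?thesis using b c \<open>A$1$1 = A$2$2\<close>
    by (auto simp: vec_eq_iff forall_2 mat_def)
qed

lemma moebius_eq_imp:
  assumes "det A = 1" "det B = 1" "moebius A = moebius B"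
  shows "A = B \<or> A = - B"
proof -
  have "invertible B" using assms(2) by (simp add: invertible_det_nz)
  then obtain C where C: "C ** B = mat 1" "B ** C = mat 1" by (auto simp: invertible_def)
  hence dC: "det C = 1" using assms(2) by (metis det_I det_mul mult.right_neutral)
  have "moebius (C ** A) = moebius (C ** B)"
    using moebius_compose[of C A] moebius_compose[of C B] assms dC by simp
  hence "C ** A = mat 1 \<or> C ** A = - mat 1"
    using moebius_eq_id_imp[of "C ** A"] C assms dC by (simp add: moebius_mat1 det_mul)
  moreover have "A = B ** (C ** A)" using C by (simp add: matrix_mul_assoc)
  moreover have "B ** (- mat 1) = - B"
    by (simp add: vec_eq_iff matrix_mult_2 forall_2 mat_def)
  ultimately show ?thesis by (metis matrix_mul_rid)
qed

lemma moebius_tr_eq: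
  assumes "det A = 1"
  shows "moebius_tr (moebius A) = \<bar>trace A\<bar>"
  unfolding moebius_tr_def
proof (rule the_equality)
  show "\<exists>B. det B = 1 \<and> moebius A = moebius B \<and> \<bar>trace A\<bar> = \<bar>trace B\<bar>"
    using assms by blast
next
  fix t assume "\<exists>B. det B = 1 \<and> moebius A = moebius B \<and> t = \<bar>trace B\<bar>"
  then obtain B where B: "det B = 1" "moebius A = moebius B" "t = \<bar>trace B\<bar>" by blast
  from moebius_eq_imp[OF assms B(1,2)] show "t = \<bar>trace A\<bar>"
    using B(3) by (auto simp: trace_def sum_2)
qed

lemma openin_moebius_topology:
  "openin moebius_topology U \<longleftrightarrow>
     U \<subseteq> carrier moebius_group \<and> openin (top_of_set SL2) {A \<in> SL2. moebius A \<in> U}"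
proof -
  have "istopology (\<lambda>U. U \<subseteq> carrier moebius_group \<and>
      openin (top_of_set SL2) {A \<in> SL2. moebius A \<in> U})"
    unfolding istopology_def
  proof (intro conjI allI impI)
    fix U V
    assume "U \<subseteq> carrier moebius_group \<and> openin (top_of_set SL2) {A \<in> SL2. moebius A \<in> U}"
      "V \<subseteq> carrier moebius_group \<and> openin (top_of_set SL2) {A \<in> SL2. moebius A \<in> V}"
    moreover have "{A \<in> SL2. moebius A \<in> U \<inter> V} =
        {A \<in> SL2. moebius A \<in> U} \<inter> {A \<in> SL2. moebius A \<in> V}" by auto
    ultimately show "U \<inter> V \<subseteq> carrier moebius_group"
      "openin (top_of_set SL2) {A \<in> SL2. moebius A \<in> U \<inter> V}" by auto
  next
    fix K
    assume K: "\<forall>U\<in>K. U \<subseteq> carrier moebius_group \<and>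
      openin (top_of_set SL2) {A \<in> SL2. moebius A \<in> U}"
    show "\<Union>K \<subseteq> carrier moebius_group" using K by blast
    have "{A \<in> SL2. moebius A \<in> \<Union>K} = (\<Union>U\<in>K. {A \<in> SL2. moebius A \<in> U})" by auto
    thus "openin (top_of_set SL2) {A \<in> SL2. moebius A \<in> \<Union>K}" using K by auto
  qed
  thus ?thesis by (simp add: moebius_topology_def topology_inverse')
qed

lemma topspace_moebius_topology: "topspace moebius_topology = carrier moebius_group"
proof -
  have "{A \<in> SL2. moebius A \<in> carrier moebius_group} = SL2"
    by (auto simp: carrier_moebius_group)
  hence "openin moebius_topology (carrier moebius_group)"
    by (auto simp: openin_moebius_topology)
  thus ?thesis
    using openin_topspace[of moebius_topology]
    by (metis openin_moebius_topology openin_subset subset_antisym)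
qed

lemma quotient_map_moebius: "quotient_map (top_of_set SL2) moebius_topology moebius"
  unfolding quotient_map_def topspace_moebius_topology openin_moebius_topology
  by (simp add: carrier_moebius_group)

end

theory Submission
  imports Defs
begin

text \<open>A word of \<open>\<langle>f, g\<rangle>\<close> that is trivial and contains \<open>f\<close> exhibits \<open>f\<inverse>\<close> as a
  word, and an elliptic element of a semidiscrete semigroup has finite order, since unit complex
  numbers are recurrent. So if the semidiscrete semigroup contains the identity and is not a group,
  then \<open>f\<close> is a finite order elliptic, and no \<open>f\<^sup>n g\<close> is elliptic, because a torsion element
  \<open>f\<^sup>n g\<close> would provide \<open>g\<inverse>\<close>.

  For the converse, identify \<open>\<real>\<^sup>2\<close> with \<open>\<complex>\<close> so that \<open>f\<close> becomes multiplication by a unit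
  complex number \<open>u\<close> and \<open>g\<close> becomes \<open>w \<mapsto> a w + b cnj w\<close>. There is a double cone \<open>C\<close>, depending
  only on \<open>a\<close> and \<open>b\<close>, such that non-ellipticity of \<open>f\<^sup>n g\<close> forces \<open>g\<close> to map
  \<open>u\<^sup>n C\<close> into \<open>C\<close>. Hence any word containing \<open>g\<close> maps all the rotated cones \<open>u\<^sup>n C\<close> into
  a single one of them, and this keeps it away from the identity.\<close>

section \<open>The Moebius group and semidiscreteness\<close>

interpretation moebius: group moebius_group
  by (rule group_moebius_group)

lemma one_moebius_group [simp]: "\<one>\<^bsub>moebius_group\<^esub> = id"
  by (simp add: moebius_group_def)

lemma id_moebius_group [simp]:
  "id \<in> carrier moebius_group" "id \<otimes>\<^bsub>moebius_group\<^esub> h = h" "h \<otimes>\<^bsub>moebius_group\<^esub> id = h"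
  using moebius.one_closed by (simp_all add: moebius_group_def)

lemma SL2_mult: "A \<in> SL2 \<Longrightarrow> B \<in> SL2 \<Longrightarrow> A ** B \<in> SL2"
  by (simp add: SL2_def det_mul)

lemma mat_1_SL2: "mat 1 \<in> SL2"
  by (simp add: SL2_def)

lemma moebius_in_carrier: "A \<in> SL2 \<Longrightarrow> moebius A \<in> carrier moebius_group"
  by (simp add: carrier_moebius_group)

lemma moebius_mult:
  "A \<in> SL2 \<Longrightarrow> B \<in> SL2 \<Longrightarrow> moebius A \<otimes>\<^bsub>moebius_group\<^esub> moebius B = moebius (A ** B)"
  using moebius_compose[of A B] by (simp add: moebius_group_def SL2_def)

lemma moebius_uminus: "moebius (- A) = moebius A"
  using moebius_scaleR[of "-1" A] by simp

lemma det_2_uminus: "det (- A :: real^2^2) = det A"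
  by (simp add: det_2)

lemma carrier_moebiusE:
  assumes "f \<in> carrier moebius_group"
  obtains A where "A \<in> SL2" "f = moebius A"
  using assms by (auto simp: carrier_moebius_group)

lemma semigroup_generated_carrier:
  assumes "X \<subseteq> carrier moebius_group" "h \<in> semigroup_generated X"
  shows "h \<in> carrier moebius_group"
  using assms(2) by induction (use assms(1) in auto)

lemma semigroup_generated_pow:
  assumes "h \<in> semigroup_generated X" "n > 0" "h \<in> carrier moebius_group"
  shows "h [^]\<^bsub>moebius_group\<^esub> (n::nat) \<in> semigroup_generated X"
  using assms(2)
proof (induction n rule: nat_induct_non_zero)
  case 1
  then show ?case using assms by simp
next
  case (Suc n)
  then show ?case using assms(1) by (auto intro: semigroup_generated.mult)
qed

text \<open>On \<open>SL2\<close> the fibres of \<open>moebius\<close> are the pairs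
  \<open>A\<close>, \<open>- A\<close>, so neighbourhoods of \<open>id\<close> correspond to balls
  around \<open>mat 1\<close> together with their negatives. This turns semidiscreteness into a
  distance condition on matrices.\<close>

lemma semidiscrete_iff:
  "semidiscrete S \<longleftrightarrow>
    (\<exists>e>0. \<forall>A\<in>SL2. moebius A \<in> S \<longrightarrow> dist A (mat 1) < e \<longrightarrow> moebius A = id)"
proof
  assume "semidiscrete S"
  then obtain U where U: "id \<in> U" "openin moebius_topology U" "\<And>h. h \<in> S \<Longrightarrow> h \<in> U \<Longrightarrow> h = id"
    unfolding semidiscrete_def in_derived_set_of topspace_moebius_topology
    using moebius.one_closed by auto
  have "openin (top_of_set SL2) {A \<in> SL2. moebius A \<in> U}" "mat 1 \<in> {A \<in> SL2. moebius A \<in> U}"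
    using U by (auto simp: openin_moebius_topology mat_1_SL2 moebius_mat1)
  then obtain e where e: "e > 0" "ball (mat 1) e \<inter> SL2 \<subseteq> {A \<in> SL2. moebius A \<in> U}"
    by (meson openin_contains_ball)
  have "moebius A = id" if "A \<in> SL2" "moebius A \<in> S" "dist A (mat 1) < e" for A
  proof (rule U(3))
    have "A \<in> ball (mat 1) e \<inter> SL2" using that by (simp add: dist_commute)
    then show "moebius A \<in> U" using e(2) by blast
  qed fact
  then show "\<exists>e>0. \<forall>A\<in>SL2. moebius A \<in> S \<longrightarrow> dist A (mat 1) < e \<longrightarrow> moebius A = id"
    using e(1) by blast
next
  assume "\<exists>e>0. \<forall>A\<in>SL2. moebius A \<in> S \<longrightarrow> dist A (mat 1) < e \<longrightarrow> moebius A = id"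
  then obtain e where e: "e > 0"
    "\<And>A. A \<in> SL2 \<Longrightarrow> moebius A \<in> S \<Longrightarrow> dist A (mat 1) < e \<Longrightarrow> moebius A = id"
    by blast
  define U where "U = moebius ` (SL2 \<inter> ball (mat 1) e)"
  \<comment> \<open>The full preimage is the ball saturated under sign change; openness in the
    quotient topology is a statement about this set.\<close>
  have "{A \<in> SL2. moebius A \<in> U} = SL2 \<inter> (ball (mat 1) e \<union> ball (- mat 1) e)"
  proof (intro equalityI subsetI)
    fix A assume "A \<in> {A \<in> SL2. moebius A \<in> U}"
    then obtain B where "A \<in> SL2" "B \<in> SL2" "B \<in> ball (mat 1) e" "moebius A = moebius B"
      by (auto simp: U_def)
    moreover from this have "A = B \<or> A = - B"
      using moebius_eq_imp by (auto simp: SL2_def)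
    ultimately show "A \<in> SL2 \<inter> (ball (mat 1) e \<union> ball (- mat 1) e)"
      by (auto simp: dist_minus)
  next
    fix A assume "A \<in> SL2 \<inter> (ball (mat 1) e \<union> ball (- mat 1) e)"
    then have "A \<in> SL2" "A \<in> ball (mat 1) e \<or> - A \<in> ball (mat 1) e"
      by (auto simp: dist_norm norm_minus_commute add.commute)
    moreover from this have "- A \<in> SL2"
      by (simp add: SL2_def det_2_uminus)
    ultimately show "A \<in> {A \<in> SL2. moebius A \<in> U}"
      unfolding U_def using moebius_uminus[of A] by (auto intro: image_eqI[of _ _ "- A"])
  qed
  then have "openin (top_of_set SL2) {A \<in> SL2. moebius A \<in> U}"
    by (simp only: openin_open_Int open_Un open_ball)
  then have "openin moebius_topology U"
    by (auto simp: openin_moebius_topology U_def moebius_in_carrier)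
  moreover have "id \<in> U"
    using e(1) by (auto simp: U_def mat_1_SL2 moebius_mat1 intro!: image_eqI[of _ _ "mat 1"])
  moreover have "h = id" if "h \<in> U" "h \<in> S" for h
  proof -
    obtain A where "A \<in> SL2" "h = moebius A" "dist A (mat 1) < e"
      using \<open>h \<in> U\<close> unfolding U_def by (auto simp: dist_commute)
    then show ?thesis using e(2) \<open>h \<in> S\<close> by blast
  qed
  ultimately show "semidiscrete S"
    unfolding semidiscrete_def in_derived_set_of by auto
qed

lemma fuchsian_imp_semidiscrete:
  assumes "fuchsian_group S"
  shows "semidiscrete S"
proof -
  have "id \<in> S" using assms subgroup.one_closed by (fastforce simp: fuchsian_group_def)
  then have "openin (subtopology moebius_topology S) {id}"
    using assms by (simp add: fuchsian_group_def)
  then obtain U where "openin moebius_topology U" "{id} = U \<inter> S"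
    by (auto simp: openin_subtopology)
  then show ?thesis
    unfolding semidiscrete_def in_derived_set_of by (auto intro!: exI[of _ U])
qed

text \<open>A neighbourhood that isolates \<open>id\<close> within the group is moved by left
  translation to isolate any other element.\<close>

lemma semidiscrete_subgroup_fuchsian:
  assumes "semidiscrete S" "subgroup S moebius_group"
  shows "fuchsian_group S"
proof -
  have S: "S \<subseteq> carrier moebius_group" using assms(2) by (rule subgroup.subset)
  obtain U where U: "id \<in> U" "openin moebius_topology U" "\<And>h. h \<in> S \<Longrightarrow> h \<in> U \<Longrightarrow> h = id"
    using assms(1) unfolding semidiscrete_def in_derived_set_of topspace_moebius_topology
    using moebius.one_closed by auto
  have UC: "U \<subseteq> carrier moebius_group" using U(2) by (simp add: openin_moebius_topology)
  have "openin (subtopology moebius_topology S) {s}" if s: "s \<in> S" for s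
  proof -
    have inv_s: "inv\<^bsub>moebius_group\<^esub> s \<in> S"
      using s assms(2) by (rule subgroup.m_inv_closed[rotated])
    obtain B where B: "B \<in> SL2" "inv\<^bsub>moebius_group\<^esub> s = moebius B"
      using inv_s S carrier_moebiusE by blast
    \<comment> \<open>\<open>V\<close> is the left translate of \<open>U\<close> by
      \<open>s\<close>. Its openness reduces to continuity of left multiplication by the matrix
      \<open>B\<close> of the inverse of \<open>s\<close>.\<close>
    define V where "V = {h \<in> carrier moebius_group. inv\<^bsub>moebius_group\<^esub> s \<otimes>\<^bsub>moebius_group\<^esub> h \<in> U}"
    have "{A \<in> SL2. moebius A \<in> V} = SL2 \<inter> (\<lambda>A. B ** A) -` {A \<in> SL2. moebius A \<in> U}"
      using B by (auto simp: V_def moebius_mult moebius_in_carrier SL2_mult)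
    moreover have "continuous_on SL2 (\<lambda>A. B ** A)"
      by (auto simp: matrix_matrix_mult_def intro!: continuous_intros)
    then have "openin (top_of_set SL2) (SL2 \<inter> (\<lambda>A. B ** A) -` {A \<in> SL2. moebius A \<in> U})"
      by (rule continuous_openin_preimage[where T = SL2])
        (use U(2) B SL2_mult in \<open>auto simp: openin_moebius_topology\<close>)
    ultimately have "openin moebius_topology V"
      by (auto simp: openin_moebius_topology V_def)
    moreover have "{s} = V \<inter> S"
    proof (intro equalityI subsetI)
      fix h assume h: "h \<in> V \<inter> S"
      then have "inv\<^bsub>moebius_group\<^esub> s \<otimes>\<^bsub>moebius_group\<^esub> h = id"
        using U(3) inv_s subgroup.m_closed[OF assms(2)] by (auto simp: V_def)
      moreover have "h \<in> carrier moebius_group" "s \<in> carrier moebius_group" using h s S by auto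
      ultimately have "h = s"
        using moebius.inv_solve_left[of id s h] by simp
      then show "h \<in> {s}" by simp
    qed (use s S U(1) in \<open>auto simp: V_def subset_eq moebius.l_inv\<close>)
    ultimately show ?thesis by (auto simp: openin_subtopology)
  qed
  then have "subtopology moebius_topology S = discrete_topology S"
    using S topspace_subtopology_subset[of S moebius_topology]
    by (metis discrete_topology_unique topspace_moebius_topology)
  then show ?thesis using assms(2) by (simp add: fuchsian_group_def)
qed

section \<open>Fixed points and torsion\<close>

lemma mat2_eqI:
  fixes A B :: "real^2^2"
  assumes "A$1$1 = B$1$1" "A$1$2 = B$1$2" "A$2$1 = B$2$1" "A$2$2 = B$2$2"
  shows "A = B"
  using assms by (simp add: vec_eq_iff forall_2)

lemma SL2_det: "A \<in> SL2 \<longleftrightarrow> A$1$1 * A$2$2 - A$1$2 * A$2$1 = 1"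
  by (simp add: SL2_def det_2)

lemma trace_2: "trace (A :: real^2^2) = A$1$1 + A$2$2"
  by (simp add: trace_def sum_2)

lemma moebius_fixes_upperI:
  assumes "A \<in> SL2" "Im z > 0"
    "of_real (A$2$1) * z\<^sup>2 + of_real (A$2$2 - A$1$1) * z - of_real (A$1$2) = 0"
  shows "moebius A (Some z) = Some z"
proof -
  have nz: "of_real (A$2$1) * z + of_real (A$2$2) \<noteq> 0"
  proof
    assume eq: "of_real (A$2$1) * z + of_real (A$2$2) = 0"
    then have "A$2$1 * Im z = 0" by (auto simp: complex_eq_iff)
    then have "A$2$1 = 0" using assms(2) by simp
    moreover from this have "A$2$2 = 0" using eq by simp
    ultimately show False using assms(1) by (simp add: SL2_det)
  qed
  have "of_real (A$1$1) * z + of_real (A$1$2) = z * (of_real (A$2$1) * z + of_real (A$2$2))"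
    using assms(3) by (simp add: algebra_simps power2_eq_square)
  then show ?thesis using nz by simp
qed

text \<open>The fixed-point equation c z^2 + (d - a) z - b = 0 has discriminant (a + d)^2 - 4 < 0,
  so one of its two conjugate roots lies in the upper half-plane.\<close>

lemma elliptic_if_trace_less_2:
  assumes "A \<in> SL2" "\<bar>trace A\<bar> < 2"
  shows "elliptic (moebius A)"
proof -
  define a b c d where abcd: "a = A$1$1" "b = A$1$2" "c = A$2$1" "d = A$2$2"
  have det: "a * d - b * c = 1" using assms(1) by (simp add: SL2_det abcd)
  have tr: "(a + d)\<^sup>2 < 4"
    using assms(2) abs_square_less_1[of "(a + d) / 2"] by (simp add: trace_2 abcd power_divide)
  have c: "c \<noteq> 0"
  proof
    assume "c = 0"
    then have "(a + d)\<^sup>2 = (a - d)\<^sup>2 + 4" using det by (simp add: power2_eq_square algebra_simps)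
    then show False using tr by (smt (verit) zero_le_power2)
  qed
  define s where "s = sqrt (4 - (a + d)\<^sup>2)"
  have s: "s > 0" "s\<^sup>2 = 4 - (a + d)\<^sup>2" using tr by (auto simp: s_def)
  \<comment> \<open>Dividing by \<open>\<bar>c\<bar>\<close> instead of \<open>c\<close> in the
    imaginary part selects the root in the upper half-plane.\<close>
  define z where "z = Complex ((a - d) / (2 * c)) (s / (2 * \<bar>c\<bar>))"
  have "of_real c * z\<^sup>2 + of_real (d - a) * z - of_real b = 0"
  proof (rule complex_eqI)
    have "c * (((a - d) / (2 * c))\<^sup>2 - (s / (2 * \<bar>c\<bar>))\<^sup>2) + (d - a) * ((a - d) / (2 * c)) - b
        = - ((a - d)\<^sup>2 + s\<^sup>2 + 4 * b * c) / (4 * c)"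
      using c unfolding power_divide power_mult_distrib power2_abs
      by (simp add: field_simps power2_eq_square)
    also have "\<dots> = 0"
      using det s(2) by (simp add: power2_eq_square algebra_simps)
    finally show "Re (of_real c * z\<^sup>2 + of_real (d - a) * z - of_real b) = Re 0"
      by (simp add: z_def power2_eq_square)
    show "Im (of_real c * z\<^sup>2 + of_real (d - a) * z - of_real b) = Im 0"
      using c by (simp add: z_def power2_eq_square field_simps)
  qed
  moreover have "Im z > 0" using s c by (simp add: z_def)
  ultimately have "moebius A (Some z) = Some z" "Some z \<in> upper_half_plane"
    using moebius_fixes_upperI[OF assms(1), of z] by (auto simp: abcd upper_half_plane_def)
  moreover have "moebius A \<noteq> id"
    using moebius_eq_id_imp[of A] assms(1) c by (auto simp: SL2_def abcd mat_def)
  ultimately show ?thesis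
    using assms(1) unfolding elliptic_def by (metis moebius_in_carrier one_moebius_group)
qed

text \<open>For trace of absolute value at least 2 the discriminant is nonnegative, so either
  infinity or a real root is fixed.\<close>

lemma moebius_fixed_point:
  assumes "A \<in> SL2"
  shows "\<exists>z\<in>closed_upper_half_plane. moebius A z = z"
proof (cases "\<bar>trace A\<bar> < 2")
  case True
  then show ?thesis
    using elliptic_if_trace_less_2[OF assms]
    by (auto simp: elliptic_def closed_upper_half_plane_def)
next
  case tr: False
  define a b c d where abcd: "a = A$1$1" "b = A$1$2" "c = A$2$1" "d = A$2$2"
  have det: "a * d - b * c = 1" using assms by (simp add: SL2_det abcd)
  show ?thesis
  proof (cases "c = 0")
    case True
    then have "moebius A None = None" by (simp add: abcd)
    then show ?thesis by (auto simp: closed_upper_half_plane_def)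
  next
    case c: False
    define s where "s = sqrt ((a + d)\<^sup>2 - 4)"
    have "(a + d)\<^sup>2 \<ge> 4"
      using tr abs_square_less_1[of "(a + d) / 2"] by (simp add: trace_2 abcd power_divide)
    then have s: "s\<^sup>2 = (a + d)\<^sup>2 - 4" by (simp add: s_def)
    define x where "x = (a - d + s) / (2 * c)"
    have cx: "2 * (c * x) = a - d + s" using c by (simp add: x_def)
    have "c * x + d \<noteq> 0"
    proof
      assume "c * x + d = 0"
      then have "s = - (a + d)" using cx by simp
      then have "s\<^sup>2 = (a + d)\<^sup>2" by (simp only: power2_minus)
      then show False using s by simp
    qed
    moreover have "a * x + b = x * (c * x + d)"
    proof -
      have "4 * c * (x * (c * x + d) - (a * x + b))
          = (2 * (c * x))\<^sup>2 + 2 * (d - a) * (2 * (c * x)) - 4 * b * c"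
        by (simp add: power2_eq_square algebra_simps)
      also have "\<dots> = s\<^sup>2 - (a - d)\<^sup>2 - 4 * b * c"
        unfolding cx by (simp add: power2_eq_square algebra_simps)
      also have "\<dots> = 0"
        using det s by (simp add: power2_eq_square algebra_simps)
      finally show ?thesis using c by simp
    qed
    ultimately have "moebius A (Some (of_real x)) = Some (of_real x)"
      by (simp add: abcd flip: of_real_mult of_real_add of_real_divide)
    then show ?thesis
      by (intro bexI[of _ "Some (of_real x)"]) (auto simp: closed_upper_half_plane_def)
  qed
qed

text \<open>By Cayley--Hamilton, the powers of \<open>A\<close> are \<open>p *\<^sub>R A - q *\<^sub>R mat 1\<close> with
  consecutive Chebyshev values \<open>p\<close>, \<open>q\<close>; these increase strictly when \<open>\<bar>trace A\<bar> \<ge> 2\<close>.\<close>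

lemma torsion_trace_less_2:
  assumes "A \<in> SL2" "moebius A [^]\<^bsub>moebius_group\<^esub> (n::nat) = id" "n > 0" "moebius A \<noteq> id"
  shows "\<bar>trace A\<bar> < 2"
proof (rule ccontr)
  assume tr: "\<not> \<bar>trace A\<bar> < 2"
  define P where "P p q = p *\<^sub>R A - q *\<^sub>R mat 1" for p q :: real
  have P_mult: "P p q ** A = P (trace A * p - q) p" for p q
  proof -
    define a b c d where abcd: "a = A$1$1" "b = A$1$2" "c = A$2$1" "d = A$2$2"
    have det: "b * c = a * d - 1" using assms(1) by (simp add: SL2_det abcd)
    have "(p * a - q) * a + p * b * c = ((a + d) * p - q) * a - p"
      "p * c * b + (p * d - q) * d = ((a + d) * p - q) * d - p"
      using arg_cong[OF det, of "\<lambda>x. p * x"] by (simp_all add: algebra_simps)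
    then show ?thesis
      by (intro mat2_eqI)
        (simp_all add: P_def matrix_mult_2 trace_2 mat_def flip: abcd, simp_all add: algebra_simps)
  qed
  \<comment> \<open>The induction starts from \<open>P 1 0 = A\<close>. The bound persists because
    the new coefficient is at least 2\<bar>p\<bar> - \<bar>q\<bar> \<ge> \<bar>p\<bar> + 1 in
    absolute value.\<close>
  have "\<exists>p q. moebius A [^]\<^bsub>moebius_group\<^esub> n = moebius (P p q) \<and> P p q \<in> SL2 \<and> \<bar>p\<bar> \<ge> \<bar>q\<bar> + 1"
    using assms(3)
  proof (induction n rule: nat_induct_non_zero)
    case 1
    then show ?case
      using assms(1) by (intro exI[of _ 1] exI[of _ 0])
        (simp add: P_def moebius_in_carrier)
  next
    case (Suc n)
    then obtain p q where pq: "moebius A [^]\<^bsub>moebius_group\<^esub> n = moebius (P p q)"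
      "P p q \<in> SL2" "\<bar>p\<bar> \<ge> \<bar>q\<bar> + 1" by blast
    have "\<bar>trace A * p\<bar> \<ge> 2 * \<bar>p\<bar>"
      using tr by (simp add: abs_mult mult_right_mono)
    then have "\<bar>trace A * p - q\<bar> \<ge> \<bar>p\<bar> + 1" using pq(3) by linarith
    then show ?case
      using pq assms(1) P_mult[of p q] SL2_mult[of "P p q" A]
      by (intro exI[of _ "trace A * p - q"] exI[of _ p]) (simp add: moebius_mult)
  qed
  then obtain p q where pq: "moebius (P p q) = id" "P p q \<in> SL2" "\<bar>p\<bar> \<ge> \<bar>q\<bar> + 1"
    unfolding assms(2) by metis
  then have "P p q = 1 *\<^sub>R mat 1 \<or> P p q = (-1) *\<^sub>R mat 1"
    using moebius_eq_id_imp[of "P p q"] by (simp add: SL2_def)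
  \<comment> \<open>If a combination with \<open>p \<noteq> 0\<close> is scalar, then
    \<open>A\<close> itself is scalar and acts as \<open>id\<close>.\<close>
  then obtain r :: real where "P p q = r *\<^sub>R mat 1" by metis
  moreover have "p \<noteq> 0" using pq(3) by auto
  ultimately have A: "A = ((q + r) / p) *\<^sub>R mat 1"
    by (simp add: P_def vec_eq_iff field_simps)
  moreover have "(q + r) / p \<noteq> 0"
    using assms(1) A by (auto simp: SL2_det)
  ultimately show False
    using assms(4) moebius_scaleR[of "(q + r) / p" "mat 1"] by (simp add: moebius_mat1)
qed

section \<open>Rotations about a point of the upper half-plane\<close>

text \<open>The matrix with eigenvalues \<open>u\<close>, \<open>cnj u\<close> and eigenvectors \<open>(z, 1)\<close>, \<open>(cnj z, 1)\<close>.\<close>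

definition rot :: "complex \<Rightarrow> complex \<Rightarrow> real^2^2" where
  "rot z u = vector [vector [Re u + Re z * (Im u / Im z), - (((Re z)\<^sup>2 + (Im z)\<^sup>2) * (Im u / Im z))],
                     vector [Im u / Im z, Re u - Re z * (Im u / Im z)]]"

lemma rot_1: "rot z 1 = mat 1"
  by (rule mat2_eqI) (simp_all add: rot_def mat_def)

lemma rot_mult: "Im z \<noteq> 0 \<Longrightarrow> rot z u ** rot z v = rot z (u * v)"
  by (rule mat2_eqI)
    (simp_all add: rot_def matrix_mult_2 field_simps power2_eq_square)

lemma det_rot: "Im z \<noteq> 0 \<Longrightarrow> det (rot z u) = (cmod u)\<^sup>2"
  unfolding cmod_power2 by (simp add: rot_def det_2 field_simps power2_eq_square)

lemma rot_SL2: "Im z \<noteq> 0 \<Longrightarrow> cmod u = 1 \<Longrightarrow> rot z u \<in> SL2"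
  by (simp add: SL2_def det_rot)

lemma continuous_rot:
  assumes "Im z \<noteq> 0"
  shows "continuous_on UNIV (rot z)"
proof -
  have "continuous_on UNIV (\<lambda>u. rot z u $ i $ j)" for i j
  proof -
    have "i = 1 \<or> i = 2" "j = 1 \<or> j = 2" using exhaust_2 by blast+
    then show ?thesis
      by (elim disjE; simp add: rot_def; intro continuous_intros; simp add: assms)
  qed
  then have "continuous_on UNIV (\<lambda>u. \<chi> i j. rot z u $ i $ j)"
    by (intro continuous_on_vec_lambda)
  then show ?thesis by simp
qed

lemma moebius_rot_pow:
  assumes "Im z \<noteq> 0" "cmod u = 1"
  shows "moebius (rot z u) [^]\<^bsub>moebius_group\<^esub> (n::nat) = moebius (rot z (u ^ n))"
proof (induction n)
  case 0
  then show ?case by (simp add: rot_1 moebius_mat1)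
next
  case (Suc n)
  then show ?case
    using assms by (simp add: moebius_mult rot_SL2 norm_power rot_mult mult.commute)
qed

text \<open>The real and imaginary parts of the fixed-point equation express a and b through c and
  d. The two remaining parameters are the real and imaginary parts of \<open>u\<close>, and the
  determinant is its squared modulus.\<close>

lemma fixes_upper_imp_rot:
  assumes "A \<in> SL2" "Im z > 0" "moebius A (Some z) = Some z"
  obtains u where "cmod u = 1" "A = rot z u"
proof -
  define a b c d where abcd: "a = A$1$1" "b = A$1$2" "c = A$2$1" "d = A$2$2"
  define x y where xy: "x = Re z" "y = Im z"
  have y: "y > 0" using assms(2) by (simp add: xy)
  have "of_real a * z + of_real b = z * (of_real c * z + of_real d)"
    using assms(3) by (simp add: abcd divide_eq_eq split: if_splits)
  then have re: "a * x + b = c * (x\<^sup>2 - y\<^sup>2) + d * x" and im: "a * y = y * (2 * c * x + d)"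
    by (simp_all add: complex_eq_iff xy power2_eq_square algebra_simps)
  have ad: "a = 2 * c * x + d" using im y by simp
  have b: "b = - (c * (x\<^sup>2 + y\<^sup>2))" using re unfolding ad by (simp add: power2_eq_square algebra_simps)
  define u where "u = Complex ((a + d) / 2) (c * y)"
  have A: "A = rot z u"
    using y ad b by (intro mat2_eqI)
      (simp_all add: rot_def u_def xy[symmetric] abcd[symmetric] field_simps)
  have "(cmod u)\<^sup>2 = 1" using assms(1,2) A det_rot[of z u] by (simp add: SL2_def)
  then have "cmod u = 1" by (simp add: power2_eq_1_iff)
       (smt (verit) norm_ge_zero)
  then show ?thesis using that A by blast
qed

text \<open>By compactness some subsequence of the powers is Cauchy; the quotient of two close terms
  is a positive power close to 1.\<close>

lemma unit_circle_recurrent: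
  fixes u :: complex
  assumes "cmod u = 1" "e > 0"
  obtains n :: nat where "n > 0" "dist (u ^ n) 1 < e"
proof -
  have "\<forall>n. u ^ n \<in> sphere 0 1" using assms by (simp add: norm_power)
  then obtain l r where r: "strict_mono r" "((\<lambda>n. u ^ n) \<circ> r) \<longlonglongrightarrow> l"
    using compact_sphere[of 0 1] unfolding compact_def by meson
  then have "Cauchy ((\<lambda>n. u ^ n) \<circ> r)" by (auto intro: LIMSEQ_imp_Cauchy)
  then obtain N where N: "dist (u ^ r N) (u ^ r (Suc N)) < e"
    using assms(2) by (auto simp: Cauchy_def) (metis le_add2 le_refl plus_1_eq_Suc)
  have lt: "r N < r (Suc N)" using r(1) by (simp add: strict_mono_Suc_iff)
  define k where "k = r (Suc N) - r N"
  have "u ^ r (Suc N) = u ^ r N * u ^ k"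
    using lt by (simp add: k_def flip: power_add)
  then have "dist (u ^ r N) (u ^ r (Suc N)) = cmod (u ^ r N * (1 - u ^ k))"
    by (simp add: dist_norm algebra_simps)
  also have "\<dots> = dist (u ^ k) 1"
    using assms(1) by (simp add: norm_mult norm_power dist_norm norm_minus_commute)
  finally show ?thesis using that[of k] N lt by (simp add: k_def)
qed

lemma ellipticE:
  assumes "elliptic h"
  obtains z u where "Im z > 0" "cmod u = 1" "h = moebius (rot z u)" "h \<noteq> id"
proof -
  obtain z where z: "Im z > 0" "h (Some z) = Some z" "h \<noteq> id" "h \<in> carrier moebius_group"
    using assms by (auto simp: elliptic_def upper_half_plane_def)
  obtain A where A: "A \<in> SL2" "h = moebius A" using z(4) by (rule carrier_moebiusE)
  show ?thesis
    using fixes_upper_imp_rot[OF A(1) z(1)] z A that by metis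
qed

text \<open>Recurrence brings some positive power of \<open>h\<close> close to \<open>id\<close>,
  and semidiscreteness then forces it to equal \<open>id\<close>.\<close>

lemma semidiscrete_elliptic_finite_order:
  assumes "semidiscrete (semigroup_generated X)" "h \<in> semigroup_generated X" "elliptic h"
  shows "finite_order h"
proof -
  obtain z u where zu: "Im z > 0" "cmod u = 1" "h = moebius (rot z u)"
    using assms(3) by (rule ellipticE)
  have hc: "h \<in> carrier moebius_group" using assms(3) by (simp add: elliptic_def)
  obtain e where e: "e > 0" "\<And>A. A \<in> SL2 \<Longrightarrow> moebius A \<in> semigroup_generated X \<Longrightarrow>
      dist A (mat 1) < e \<Longrightarrow> moebius A = id"
    using assms(1) by (auto simp: semidiscrete_iff)
  obtain d where d: "d > 0" "\<And>v. dist v 1 < d \<Longrightarrow> dist (rot z v) (mat 1) < e"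
    using continuous_rot[of z] e(1) zu(1) unfolding continuous_on_iff by (metis UNIV_I less_irrefl rot_1)
  obtain n :: nat where n: "n > 0" "dist (u ^ n) 1 < d"
    using unit_circle_recurrent[OF zu(2) d(1)] .
  have pow: "h [^]\<^bsub>moebius_group\<^esub> n = moebius (rot z (u ^ n))"
    using zu by (simp add: moebius_rot_pow)
  then have "moebius (rot z (u ^ n)) = id"
    using e(2)[of "rot z (u ^ n)"] d(2)[OF n(2)] zu semigroup_generated_pow[OF assms(2) n(1) hc]
    by (simp add: rot_SL2 norm_power)
  then show ?thesis using n(1) pow by (auto simp: finite_order_def)
qed

lemma common_fixed_point_elementary:
  assumes "\<And>h. h \<in> X \<Longrightarrow> h p = p" "p \<in> closed_upper_half_plane"
  shows "elementary (semigroup_generated X)"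
proof -
  have "h p = p" if "h \<in> semigroup_generated X" for h
    using that by induction (use assms(1) in \<open>auto simp: moebius_group_def\<close>)
  then have "semigroup_orbit (semigroup_generated X) p \<subseteq> {p}"
    by (auto simp: semigroup_orbit_def)
  then show ?thesis
    using assms(2) finite_subset unfolding elementary_def by blast
qed

section \<open>Semigroups containing the identity\<close>

text \<open>A word either contains the letter \<open>f\<close> or is a power of \<open>g\<close>;
  \<open>insert id\<close> accounts for an empty prefix or suffix.\<close>

lemma semigroup_generated_cases:
  assumes "h \<in> semigroup_generated {f, g}" "f \<in> carrier moebius_group" "g \<in> carrier moebius_group"
  shows "(\<exists>u \<in> insert id (semigroup_generated {f, g}). \<exists>v \<in> insert id (semigroup_generated {f, g}).
      h = u \<otimes>\<^bsub>moebius_group\<^esub> (f \<otimes>\<^bsub>moebius_group\<^esub> v)) \<or>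
    (\<exists>n::nat. n > 0 \<and> h = g [^]\<^bsub>moebius_group\<^esub> n)"
proof -
  define S where "S = semigroup_generated {f, g}"
  have S: "x \<in> carrier moebius_group" if "x \<in> insert id S" for x
    using that assms(2,3) semigroup_generated_carrier[of "{f, g}" x] by (auto simp: S_def)
  have closed: "x \<otimes>\<^bsub>moebius_group\<^esub> y \<in> insert id S" if "x \<in> insert id S" "y \<in> insert id S" for x y
    using that semigroup_generated.mult[of x "{f, g}" y] by (auto simp: S_def)
  let ?P = "\<lambda>h. (\<exists>u \<in> insert id S. \<exists>v \<in> insert id S. h = u \<otimes>\<^bsub>moebius_group\<^esub> (f \<otimes>\<^bsub>moebius_group\<^esub> v))"
  let ?Q = "\<lambda>h. (\<exists>n::nat. n > 0 \<and> h = g [^]\<^bsub>moebius_group\<^esub> n)"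
  have "?P h \<or> ?Q h"
    using assms(1)
  proof induction
    case (gen h)
    then consider "h = f" | "h = g" by auto
    then show ?case
    proof cases
      case 1
      then have "h = id \<otimes>\<^bsub>moebius_group\<^esub> (f \<otimes>\<^bsub>moebius_group\<^esub> id)" by simp
      then show ?thesis by blast
    next
      case 2
      then have "h = g [^]\<^bsub>moebius_group\<^esub> (1::nat)" using assms(3) by simp
      then show ?thesis by blast
    qed
  next
    case (mult h k)
    have hk: "h \<in> insert id S" "k \<in> insert id S"
      using mult.hyps by (simp_all add: S_def)
    show ?case
    proof (cases "?P h")
      case True
      then obtain u v where uv: "u \<in> insert id S" "v \<in> insert id S"
        "h = u \<otimes>\<^bsub>moebius_group\<^esub> (f \<otimes>\<^bsub>moebius_group\<^esub> v)" by blast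
      then have "h \<otimes>\<^bsub>moebius_group\<^esub> k =
          u \<otimes>\<^bsub>moebius_group\<^esub> (f \<otimes>\<^bsub>moebius_group\<^esub> (v \<otimes>\<^bsub>moebius_group\<^esub> k))"
        using S hk assms(2) by (simp only: moebius.m_assoc moebius.m_closed)
      then show ?thesis using uv closed[OF uv(2) hk(2)] by blast
    next
      case False
      then obtain n where n: "n > 0" "h = g [^]\<^bsub>moebius_group\<^esub> (n::nat)" using mult.IH(1) by blast
      show ?thesis
      proof (cases "?P k")
        case True
        then obtain u v where uv: "u \<in> insert id S" "v \<in> insert id S"
          "k = u \<otimes>\<^bsub>moebius_group\<^esub> (f \<otimes>\<^bsub>moebius_group\<^esub> v)" by blast
        then have "h \<otimes>\<^bsub>moebius_group\<^esub> k =
            (h \<otimes>\<^bsub>moebius_group\<^esub> u) \<otimes>\<^bsub>moebius_group\<^esub> (f \<otimes>\<^bsub>moebius_group\<^esub> v)"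
          using S hk assms(2) by (simp only: moebius.m_assoc moebius.m_closed)
        then show ?thesis using uv closed[OF hk(1) uv(1)] by blast
      next
        case False
        then obtain m where m: "m > 0" "k = g [^]\<^bsub>moebius_group\<^esub> (m::nat)" using mult.IH(2) by blast
        have "h \<otimes>\<^bsub>moebius_group\<^esub> k = g [^]\<^bsub>moebius_group\<^esub> (n + m)"
          using assms(3) by (simp add: n m moebius.nat_pow_mult)
        then show ?thesis using n(1) by (metis add_gr_0)
      qed
    qed
  qed
  then show ?thesis by (simp add: S_def)
qed

text \<open>A trivial word \<open>u f v\<close> can be rotated cyclically to \<open>f v u\<close>,
  which exhibits \<open>v u\<close> as the inverse of \<open>f\<close>. A trivial word without
  \<open>f\<close> is a power of \<open>g\<close>.\<close>

lemma inv_mem_or_torsion: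
  assumes "f \<in> carrier moebius_group" "g \<in> carrier moebius_group" "id \<in> semigroup_generated {f, g}"
  shows "inv\<^bsub>moebius_group\<^esub> f \<in> semigroup_generated {f, g} \<or>
    (\<exists>n::nat. n > 0 \<and> g [^]\<^bsub>moebius_group\<^esub> n = id)"
proof (rule disjCI)
  assume "\<not> (\<exists>n::nat. n > 0 \<and> g [^]\<^bsub>moebius_group\<^esub> n = id)"
  then obtain u v where uv: "u \<in> semigroup_generated {f, g}" "v \<in> semigroup_generated {f, g}"
      "id = u \<otimes>\<^bsub>moebius_group\<^esub> (f \<otimes>\<^bsub>moebius_group\<^esub> v)"
    \<comment> \<open>Since \<open>id\<close> is itself a word, empty prefixes and suffixes are also
      words.\<close>
    using semigroup_generated_cases[OF assms(3,1,2)] assms(3) by (metis insert_absorb)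
  have c: "u \<in> carrier moebius_group" "v \<in> carrier moebius_group"
    using uv assms semigroup_generated_carrier[of "{f, g}"] by auto
  have "(f \<otimes>\<^bsub>moebius_group\<^esub> v) \<otimes>\<^bsub>moebius_group\<^esub> u = id"
    using uv(3) c assms(1) moebius.inv_comm[of u "f \<otimes>\<^bsub>moebius_group\<^esub> v"] by simp
  then have "f \<otimes>\<^bsub>moebius_group\<^esub> (v \<otimes>\<^bsub>moebius_group\<^esub> u) = id"
    using c assms(1) by (simp add: moebius.m_assoc)
  then have "inv\<^bsub>moebius_group\<^esub> f = v \<otimes>\<^bsub>moebius_group\<^esub> u"
    using c assms(1) moebius.inv_comm[of f "v \<otimes>\<^bsub>moebius_group\<^esub> u"]
      moebius.inv_equality[of "v \<otimes>\<^bsub>moebius_group\<^esub> u" f] by simp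
  then show "inv\<^bsub>moebius_group\<^esub> f \<in> semigroup_generated {f, g}"
    using uv semigroup_generated.mult by metis
qed

lemma semigroup_generated_subgroup:
  assumes "X \<subseteq> carrier moebius_group" "id \<in> semigroup_generated X"
    and inv: "\<And>h. h \<in> X \<Longrightarrow> inv\<^bsub>moebius_group\<^esub> h \<in> semigroup_generated X"
  shows "subgroup (semigroup_generated X) moebius_group"
proof (rule moebius.subgroupI)
  show "semigroup_generated X \<subseteq> carrier moebius_group"
    using semigroup_generated_carrier[OF assms(1)] by blast
  show "semigroup_generated X \<noteq> {}" using assms(2) by blast
  fix h assume "h \<in> semigroup_generated X"
  then show "inv\<^bsub>moebius_group\<^esub> h \<in> semigroup_generated X"
  proof induction
    case (gen h)
    then show ?case by (rule inv)
  next
    case (mult h k)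
    then show ?case
      using semigroup_generated_carrier[OF assms(1)]
      by (simp add: moebius.inv_mult_group semigroup_generated.mult)
  qed
qed (rule semigroup_generated.mult)

text \<open>The inverse is the power of \<open>h\<close> with exponent \<open>n - 1\<close>;
  membership of \<open>id\<close> covers \<open>n = 1\<close>.\<close>

lemma torsion_inv_mem:
  assumes "h \<in> semigroup_generated X" "h \<in> carrier moebius_group" "id \<in> semigroup_generated X"
    "n > 0" "h [^]\<^bsub>moebius_group\<^esub> (n::nat) = id"
  shows "inv\<^bsub>moebius_group\<^esub> h \<in> semigroup_generated X"
proof -
  have "h [^]\<^bsub>moebius_group\<^esub> (n - 1) \<otimes>\<^bsub>moebius_group\<^esub> h = id"
    using assms(4,5) moebius.nat_pow_Suc[of h "n - 1"] by simp
  then have "inv\<^bsub>moebius_group\<^esub> h = h [^]\<^bsub>moebius_group\<^esub> (n - 1)"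
    using moebius.inv_equality assms(2) by simp
  moreover have "h [^]\<^bsub>moebius_group\<^esub> (n - 1) \<in> semigroup_generated X"
    using semigroup_generated_pow[OF assms(1) _ assms(2), of "n - 1"] assms(3)
    by (cases "n - 1 = 0") (simp_all del: One_nat_def)
  ultimately show ?thesis by simp
qed

text \<open>Otherwise a fixed point of \<open>g\<close> would be fixed by both generators.\<close>

lemma nonelementary_generator_not_id:
  assumes "\<not> elementary (semigroup_generated {f, g})" "g \<in> carrier moebius_group"
  shows "f \<noteq> id"
proof
  assume f: "f = id"
  obtain A where "A \<in> SL2" "g = moebius A" using assms(2) by (rule carrier_moebiusE)
  then obtain z where "z \<in> closed_upper_half_plane" "g z = z" using moebius_fixed_point by blast
  then have "\<And>h. h \<in> {f, g} \<Longrightarrow> h z = z" using f by auto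
  then show False
    using common_fixed_point_elementary[of "{f, g}" z] assms(1) \<open>z \<in> _\<close> by blast
qed

lemma torsion_tr_less_2:
  assumes "h \<in> carrier moebius_group" "h [^]\<^bsub>moebius_group\<^esub> (n::nat) = id" "n > 0" "h \<noteq> id"
  shows "moebius_tr h < 2"
proof -
  obtain A where "A \<in> SL2" "h = moebius A" using assms(1) by (rule carrier_moebiusE)
  then show ?thesis using torsion_trace_less_2[of A n] assms by (simp add: moebius_tr_eq SL2_def)
qed

lemma tr_less_2_elliptic:
  assumes "h \<in> carrier moebius_group" "moebius_tr h < 2"
  shows "elliptic h"
proof -
  obtain A where "A \<in> SL2" "h = moebius A" using assms(1) by (rule carrier_moebiusE)
  then show ?thesis using elliptic_if_trace_less_2[of A] assms by (simp add: moebius_tr_eq SL2_def)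
qed

text \<open>If the inverses of both generators were words, the semigroup would be a semidiscrete
  group, hence Fuchsian. The rest is played off against this; the trace inequality decides which
  generator is torsion.\<close>

lemma semidiscrete_trichotomy:
  assumes f: "f \<in> carrier moebius_group" and g: "g \<in> carrier moebius_group"
    and tr: "moebius_tr f \<le> moebius_tr g"
    and ne: "\<not> elementary (semigroup_generated {f, g})"
    and sd: "semidiscrete (semigroup_generated {f, g})"
    and inv: "\<not> inverse_free (semigroup_generated {f, g})"
    and nfuchs: "\<not> fuchsian_group (semigroup_generated {f, g})"
  shows "elliptic f \<and> finite_order f \<and>
    (\<forall>n::nat. \<not> elliptic (f [^]\<^bsub>moebius_group\<^esub> n \<otimes>\<^bsub>moebius_group\<^esub> g))"
proof -
  define S where "S = semigroup_generated {f, g}"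
  have S: "S = semigroup_generated {g, f}" by (simp add: S_def insert_commute)
  have fg: "f \<in> S" "g \<in> S" by (auto simp: S_def semigroup_generated.gen)
  have id: "id \<in> S" using inv by (simp add: inverse_free_def S_def)
  have nid: "f \<noteq> id" "g \<noteq> id"
    using nonelementary_generator_not_id[of f g] nonelementary_generator_not_id[of g f] ne f g
    by (simp_all add: insert_commute)
  have not_both: "\<not> (inv\<^bsub>moebius_group\<^esub> f \<in> S \<and> inv\<^bsub>moebius_group\<^esub> g \<in> S)"
    using semigroup_generated_subgroup[of "{f, g}"] semidiscrete_subgroup_fuchsian[OF sd]
      nfuchs id f g by (auto simp: S_def)
  have torsion: "\<exists>n::nat. n > 0 \<and> f [^]\<^bsub>moebius_group\<^esub> n = id"
  proof (rule ccontr)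
    \<comment> \<open>If \<open>f\<close> is not torsion, the trivial word contains
      \<open>g\<close>, so the inverse of \<open>g\<close> is a word and that of \<open>f\<close> is
      not. Hence \<open>g\<close> is torsion, and the trace inequality makes \<open>f\<close>
      elliptic, so of finite order after all.\<close>
    assume no: "\<not> ?thesis"
    then have "inv\<^bsub>moebius_group\<^esub> g \<in> S"
      using inv_mem_or_torsion[of g f] f g id unfolding S by blast
    then obtain n :: nat where "n > 0" "g [^]\<^bsub>moebius_group\<^esub> n = id"
      using not_both inv_mem_or_torsion[of f g] f g id unfolding S_def by blast
    then have "moebius_tr f < 2" using torsion_tr_less_2 g nid(2) tr by fastforce
    then have "finite_order f"
      using tr_less_2_elliptic semidiscrete_elliptic_finite_order[OF sd] f fg(1) by (simp add: S_def)
    then show False using no by (auto simp: finite_order_def)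
  qed
  then have inv_f: "inv\<^bsub>moebius_group\<^esub> f \<in> S"
    using torsion_inv_mem[of f "{f, g}"] f fg(1) id by (auto simp: S_def)
  have "\<not> elliptic (f [^]\<^bsub>moebius_group\<^esub> n \<otimes>\<^bsub>moebius_group\<^esub> g)" for n :: nat
  proof
    assume ell: "elliptic (f [^]\<^bsub>moebius_group\<^esub> n \<otimes>\<^bsub>moebius_group\<^esub> g)"
    define h where "h = f [^]\<^bsub>moebius_group\<^esub> n"
    have h: "h \<in> S" "h \<in> carrier moebius_group"
      using semigroup_generated_pow[of f "{f, g}" n] id f fg(1) unfolding S_def h_def
      by (cases "n = 0"; simp)+
    have hg: "h \<otimes>\<^bsub>moebius_group\<^esub> g \<in> S"
      using h(1) fg(2) semigroup_generated.mult unfolding S_def by blast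
    have "finite_order (h \<otimes>\<^bsub>moebius_group\<^esub> g)"
      using semidiscrete_elliptic_finite_order[OF sd] ell hg by (simp add: h_def S_def)
    then have "inv\<^bsub>moebius_group\<^esub> (h \<otimes>\<^bsub>moebius_group\<^esub> g) \<in> S"
      using torsion_inv_mem[of "h \<otimes>\<^bsub>moebius_group\<^esub> g" "{f, g}"] hg h g id
      by (auto simp: finite_order_def S_def)
    \<comment> \<open>Multiplying the inverse of \<open>h g\<close> by \<open>h\<close> on the right
      leaves the inverse of \<open>g\<close>.\<close>
    then have "inv\<^bsub>moebius_group\<^esub> (h \<otimes>\<^bsub>moebius_group\<^esub> g) \<otimes>\<^bsub>moebius_group\<^esub> h \<in> S"
      using h(1) semigroup_generated.mult unfolding S_def by blast
    then have "inv\<^bsub>moebius_group\<^esub> g \<in> S"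
      using h(2) g by (simp add: moebius.inv_mult_group moebius.m_assoc moebius.l_inv)
    then show False using not_both inv_f by blast
  qed
  moreover have "elliptic f"
    using torsion torsion_tr_less_2 tr_less_2_elliptic f nid(1) by blast
  ultimately show ?thesis using torsion by (auto simp: finite_order_def)
qed

section \<open>Disc coordinates and cones\<close>

text \<open>In the coordinate \<open>x - cnj z * y\<close> of the vector \<open>(x, y)\<close>, the matrix \<open>A\<close> acts as
  \<open>w \<mapsto> disc_a z A * w + disc_b z A * cnj w\<close>.\<close>

definition disc_a :: "complex \<Rightarrow> real^2^2 \<Rightarrow> complex" where
  "disc_a z A = (of_real (A$1$1) * z + of_real (A$1$2) - cnj z * (of_real (A$2$1) * z + of_real (A$2$2)))
     / (z - cnj z)"

definition disc_b :: "complex \<Rightarrow> real^2^2 \<Rightarrow> complex" where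
  "disc_b z A = (of_real (A$1$1) * cnj z + of_real (A$1$2) - cnj z * (of_real (A$2$1) * cnj z + of_real (A$2$2)))
     / (cnj z - z)"

lemma disc_cnj:
  "cnj (disc_a z A) = (of_real (A$1$1) * cnj z + of_real (A$1$2) - z * (of_real (A$2$1) * cnj z + of_real (A$2$2)))
     / (cnj z - z)"
  "cnj (disc_b z A) = (of_real (A$1$1) * z + of_real (A$1$2) - z * (of_real (A$2$1) * z + of_real (A$2$2)))
     / (z - cnj z)"
  by (simp_all add: disc_a_def disc_b_def)

lemma diff_cnj_nonzero: "Im z \<noteq> 0 \<Longrightarrow> z - cnj z \<noteq> 0"
  by (simp add: complex_eq_iff)

text \<open>These are the rules for composing real-linear maps w -> a w + b cnj w.\<close>

lemma disc_mult:
  assumes "Im z \<noteq> 0"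
  shows "disc_a z (A ** B) = disc_a z A * disc_a z B + disc_b z A * cnj (disc_b z B)"
    and "disc_b z (A ** B) = disc_a z A * disc_b z B + disc_b z A * cnj (disc_a z B)"
proof -
  define d where "d = z - cnj z"
  have d: "d \<noteq> 0" "cnj z - z = - d" using diff_cnj_nonzero[OF assms] by (simp_all add: d_def)
  define c where "c = cnj z"
  \<comment> \<open>In the variables \<open>c\<close> and \<open>d\<close> the claim is a rational
    identity whose only denominator is \<open>d\<close>.\<close>
  have z: "z = c + d" by (simp add: c_def d_def)
  show "disc_a z (A ** B) = disc_a z A * disc_a z B + disc_b z A * cnj (disc_b z B)"
    unfolding disc_cnj unfolding disc_a_def disc_b_def d(2) d_def[symmetric] c_def[symmetric]
    using d(1) by (simp add: z matrix_mult_2 field_simps)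
  show "disc_b z (A ** B) = disc_a z A * disc_b z B + disc_b z A * cnj (disc_a z B)"
    unfolding disc_cnj unfolding disc_a_def disc_b_def d(2) d_def[symmetric] c_def[symmetric]
    using d(1) by (simp add: z matrix_mult_2 field_simps)
qed

text \<open>The left side is the determinant of w -> a w + b cnj w, and determinants do not depend
  on coordinates. The trace is treated likewise in \<open>disc_trace\<close>.\<close>

lemma disc_norm:
  assumes "Im z \<noteq> 0"
  shows "(cmod (disc_a z A))\<^sup>2 - (cmod (disc_b z A))\<^sup>2 = det A"
proof -
  define d where "d = z - cnj z"
  have d: "d \<noteq> 0" "cnj z - z = - d" using diff_cnj_nonzero[OF assms] by (simp_all add: d_def)
  define c where "c = cnj z"
  have z: "z = c + d" by (simp add: c_def d_def)
  have "disc_a z A * cnj (disc_a z A) - disc_b z A * cnj (disc_b z A) = of_real (det A)"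
    unfolding disc_cnj unfolding disc_a_def disc_b_def d(2) d_def[symmetric] c_def[symmetric]
    using d(1) by (simp add: z det_2 field_simps)
  then have "complex_of_real ((cmod (disc_a z A))\<^sup>2 - (cmod (disc_b z A))\<^sup>2) = of_real (det A)"
    by (simp only: of_real_diff complex_norm_square)
  then show ?thesis by (simp only: of_real_eq_iff)
qed

lemma disc_trace:
  assumes "Im z \<noteq> 0"
  shows "2 * Re (disc_a z A) = trace A"
proof -
  define d where "d = z - cnj z"
  have d: "d \<noteq> 0" "cnj z - z = - d" using diff_cnj_nonzero[OF assms] by (simp_all add: d_def)
  define c where "c = cnj z"
  have z: "z = c + d" by (simp add: c_def d_def)
  have "disc_a z A + cnj (disc_a z A) = of_real (trace A)"
    unfolding disc_cnj unfolding disc_a_def d(2) d_def[symmetric] c_def[symmetric]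
    using d(1) by (simp add: z trace_2 field_simps)
  then show ?thesis unfolding complex_add_cnj by (simp only: of_real_eq_iff)
qed

lemma disc_rot:
  assumes "Im z \<noteq> 0"
  shows "disc_a z (rot z u) = u" and "disc_b z (rot z u) = 0"
  using assms by (simp_all add: disc_a_def disc_b_def rot_def complex_eq_iff Re_divide Im_divide
      field_simps power2_eq_square)

lemma disc_1: "Im z \<noteq> 0 \<Longrightarrow> disc_a z (mat 1) = 1 \<and> disc_b z (mat 1) = 0"
  using disc_rot[of z 1] by (simp add: rot_1)

text \<open>The numerator of \<open>cnj (disc_b z A)\<close> is the negative of the fixed-point
  quadratic at \<open>z\<close>.\<close>

lemma disc_b_eq_0_imp_fixed:
  assumes "Im z > 0" "A \<in> SL2" "disc_b z A = 0"
  shows "moebius A (Some z) = Some z"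
proof (rule moebius_fixes_upperI[OF assms(2,1)])
  have "cnj (disc_b z A) = 0" using assms(3) by simp
  then have "of_real (A$1$1) * z + of_real (A$1$2) - z * (of_real (A$2$1) * z + of_real (A$2$2)) = 0"
    unfolding disc_cnj using diff_cnj_nonzero[of z] assms(1) by (simp del: complex_diff_cnj)
  then show "of_real (A$2$1) * z\<^sup>2 + of_real (A$2$2 - A$1$1) * z - of_real (A$1$2) = 0"
    by (simp add: algebra_simps power2_eq_square)
qed

text \<open>This is the action on vectors, not on the half-plane, so \<open>A\<close> and
  \<open>- A\<close> act differently; the cones below absorb the sign.\<close>

definition disc_act :: "complex \<Rightarrow> real^2^2 \<Rightarrow> complex \<Rightarrow> complex" where
  "disc_act z A w = disc_a z A * w + disc_b z A * cnj w"

lemma disc_act_mult: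
  "Im z \<noteq> 0 \<Longrightarrow> disc_act z (A ** B) w = disc_act z A (disc_act z B w)"
  by (simp add: disc_act_def disc_mult algebra_simps)

lemma disc_act_rot: "Im z \<noteq> 0 \<Longrightarrow> disc_act z (rot z u) w = u * w"
  by (simp add: disc_act_def disc_rot)

lemma disc_act_uminus: "disc_act z (- A) w = - disc_act z A w"
proof -
  have "disc_a z (- A) = - disc_a z A" "disc_b z (- A) = - disc_b z A"
    unfolding disc_a_def disc_b_def minus_divide_left by (simp_all add: algebra_simps)
  then show ?thesis by (simp add: disc_act_def)
qed

lemma disc_act_near_id:
  assumes "Im z \<noteq> 0" "e > 0"
  obtains d where "d > 0" "\<And>A w. dist A (mat 1) < d \<Longrightarrow> cmod w = 1 \<Longrightarrow> dist (disc_act z A w) w < e"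
proof -
  define F where "F A = cmod (disc_a z A - 1) + cmod (disc_b z A)" for A
  have "continuous_on UNIV F"
    unfolding F_def disc_a_def disc_b_def
    using diff_cnj_nonzero[OF assms(1)] by (intro continuous_intros) (auto simp del: complex_diff_cnj)
  moreover have "F (mat 1) = 0" using assms(1) by (simp add: F_def disc_1)
  ultimately obtain d where d: "d > 0" "\<And>A. dist A (mat 1) < d \<Longrightarrow> dist (F A) 0 < e"
    using assms(2) unfolding continuous_on_iff by (metis UNIV_I)
  have "dist (disc_act z A w) w < e" if "dist A (mat 1) < d" "cmod w = 1" for A w
  proof -
    have "disc_act z A w - w = (disc_a z A - 1) * w + disc_b z A * cnj w"
      by (simp add: disc_act_def algebra_simps)
    then have "dist (disc_act z A w) w \<le> F A"
      using norm_triangle_ineq[of "(disc_a z A - 1) * w" "disc_b z A * cnj w"] that(2)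
      by (simp add: dist_norm norm_mult F_def)
    also have "F A < e" using d(2)[OF that(1)] by (simp add: dist_norm)
    finally show ?thesis .
  qed
  then show ?thesis using that d(1) by blast
qed

section \<open>Double cones in the disc coordinate\<close>

text \<open>With \<open>k = \<bar>a\<bar> - \<bar>b\<bar>\<close> and \<open>\<bar>a\<bar>\<^sup>2 - \<bar>b\<bar>\<^sup>2 = 1\<close>, the map \<open>w \<mapsto> a w + b cnj w\<close> is
  \<open>diag(1/k, k)\<close> between two rotations, and \<open>double_cone a b\<close> is the rotated image of
  \<open>{x + i y. \<bar>y\<bar> \<le> k \<bar>x\<bar>}\<close>.\<close>

definition double_cone :: "complex \<Rightarrow> complex \<Rightarrow> complex set" where
  "double_cone a b = {w. Re (cnj (a * b) * w\<^sup>2) \<ge> (cmod b)\<^sup>2 * (cmod w)\<^sup>2}"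

lemma uminus_in_double_cone: "- w \<in> double_cone a b \<longleftrightarrow> w \<in> double_cone a b"
  by (simp add: double_cone_def)

text \<open>The map pulls the quadratic form defining the cone back to the form in the second
  hypothesis, scaled by the determinant.\<close>

lemma image_in_double_cone:
  assumes "(cmod a)\<^sup>2 - (cmod b)\<^sup>2 = 1"
    and "Re (a * cnj b * w\<^sup>2) \<ge> - ((cmod b)\<^sup>2 * (cmod w)\<^sup>2)"
  shows "a * w + b * cnj w \<in> double_cone a b"
proof -
  have "Re (cnj (a * b) * (a * w + b * cnj w)\<^sup>2) - (cmod b)\<^sup>2 * (cmod (a * w + b * cnj w))\<^sup>2
      = ((cmod a)\<^sup>2 - (cmod b)\<^sup>2) * (Re (a * cnj b * w\<^sup>2) + (cmod b)\<^sup>2 * (cmod w)\<^sup>2)"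
    unfolding cmod_power2 by (simp, simp add: power2_eq_square algebra_simps)
  then show ?thesis using assms by (simp add: double_cone_def)
qed

text \<open>For x = A + iB and y = U + iV the claim bounds Re (x y). Let \<theta> be the angle with
  cosine sqrt (t / (1 + t)). The hypotheses give \<bar>arg x\<bar> \<le> \<pi> - 2\<theta> and, for
  y nonzero, \<bar>arg y\<bar> \<le> \<theta>, so the angles add up to at most \<pi> - \<theta>. The
  proof replaces angles by squaring.\<close>

lemma planar_angle_bound:
  fixes A B U V t :: real
  assumes "t \<ge> 0" "A \<ge> 1 - t" "A\<^sup>2 + B\<^sup>2 = (1 + t)\<^sup>2" "U \<ge> t" "U\<^sup>2 + V\<^sup>2 = t * (1 + t)"
  shows "U * A - V * B \<ge> - (t * (1 + t))"
proof -
  define r where "r = t * (1 + t)"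
  have "U \<le> 1 + t"
  proof (rule power2_le_imp_le)
    have "U\<^sup>2 \<le> t * (1 + t)" using assms(5) by (smt (verit) zero_le_power2)
    also have "\<dots> \<le> (1 + t)\<^sup>2" using assms(1) by (simp add: power2_eq_square algebra_simps)
    finally show "U\<^sup>2 \<le> (1 + t)\<^sup>2" .
  qed (use assms(1) in simp)
  have pos: "U * A + r \<ge> 0"
  proof -
    have "U * A \<ge> U * (- t)" using assms(1,2,4) by (intro mult_left_mono) auto
    moreover have "U * t \<le> (1 + t) * t" using \<open>U \<le> 1 + t\<close> assms(1) by (rule mult_right_mono)
    ultimately show ?thesis by (simp add: r_def algebra_simps)
  qed
  have "(V * B)\<^sup>2 \<le> (U * A + r)\<^sup>2"
  proof -
    have B: "B\<^sup>2 = (1 + t)\<^sup>2 - A\<^sup>2" and V: "V\<^sup>2 = t * (1 + t) - U\<^sup>2" using assms by linarith+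
    have "(U * A + r)\<^sup>2 - (V * B)\<^sup>2 = (1 + t) * (t * (A + U)\<^sup>2 + U\<^sup>2 - r)"
      unfolding power_mult_distrib B V r_def by (simp add: power2_eq_square algebra_simps)
    \<comment> \<open>The hypotheses enter through A + U \<ge> 1 and U \<ge> t.\<close>
    moreover have "t * (A + U)\<^sup>2 + U\<^sup>2 - r \<ge> 0"
    proof -
      have "t * 1 \<le> t * (A + U)\<^sup>2"
        using assms by (intro mult_left_mono one_le_power) auto
      moreover have "t * t \<le> U * U" using assms by (intro mult_mono) auto
      ultimately show ?thesis by (simp add: r_def power2_eq_square algebra_simps)
    qed
    ultimately show ?thesis using assms(1) by (smt (verit) mult_nonneg_nonneg)
  qed
  then have "\<bar>V * B\<bar> \<le> U * A + r" using pos by (metis abs_le_square_iff abs_of_nonneg)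
  then show ?thesis by (simp add: r_def)
qed

text \<open>Non-ellipticity enters here as the trace bound
  \<open>\<bar>Re (u * a)\<bar> \<ge> 1\<close>, which limits the argument of (u a)^2, while the
  cone limits that of cnj (a b) w^2. \<open>planar_angle_bound\<close> combines the two.\<close>

lemma rotated_double_cone_avoids:
  assumes ab: "(cmod a)\<^sup>2 - (cmod b)\<^sup>2 = 1" and u: "cmod u = 1" "\<bar>Re (u * a)\<bar> \<ge> 1"
    and w: "w \<in> double_cone a b"
  shows "Re (a * cnj b * (u * w)\<^sup>2) \<ge> - ((cmod b)\<^sup>2 * (cmod (u * w))\<^sup>2)"
proof (cases "w = 0")
  case False
  define t N where "t = (cmod b)\<^sup>2" and "N = (cmod w)\<^sup>2"
  have a: "(cmod a)\<^sup>2 = 1 + t" using ab by (simp add: t_def)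
  have t: "t \<ge> 0" and N: "N > 0" using False by (simp_all add: t_def N_def)
  \<comment> \<open>The product \<open>x * y\<close> is the quantity to be bounded, up to the
    positive factor (1 + t) / N.\<close>
  define x where "x = (u * a)\<^sup>2"
  define y where "y = cnj (a * b) * w\<^sup>2 / of_real N"
  have cx: "cmod x = 1 + t" using u(1) a by (simp add: x_def norm_mult norm_power)
  have "cmod y = cmod a * cmod b"
    using N by (simp add: y_def norm_mult norm_power norm_divide flip: N_def)
  then have cy: "(cmod y)\<^sup>2 = t * (1 + t)" using a by (simp add: power_mult_distrib t_def)
  have "Re (u * a) ^ 2 \<ge> 1" using u(2) by (metis abs_le_square_iff abs_one one_power2)
  moreover have "(Re (u * a))\<^sup>2 + (Im (u * a))\<^sup>2 = 1 + t"
    unfolding cmod_power2[symmetric] using a u(1) by (simp add: norm_mult)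
  moreover have "Re x = (Re (u * a))\<^sup>2 - (Im (u * a))\<^sup>2"
    by (simp add: x_def power2_eq_square)
  ultimately have "Re x \<ge> 1 - t" by linarith
  moreover have "Re y \<ge> t"
    using w N by (simp add: y_def double_cone_def t_def pos_le_divide_eq flip: N_def)
  ultimately have "Re y * Re x - Im y * Im x \<ge> - (t * (1 + t))"
    using planar_angle_bound[of t "Re x" "Im x" "Re y" "Im y"] t cx cy by (simp flip: cmod_power2)
  then have xy: "Re (x * y) \<ge> - (t * (1 + t))" by (simp add: algebra_simps)
  have "a * cnj a = of_real (1 + t)" using a by (simp flip: complex_norm_square)
  then have "of_real (1 + t) * (a * cnj b * (u * w)\<^sup>2) = (a * cnj a) * (a * cnj b * (u * w)\<^sup>2)"
    by simp
  also have "\<dots> = of_real N * (x * y)"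
    using N by (simp add: x_def y_def power2_eq_square)
  finally have "Re (of_real (1 + t) * (a * cnj b * (u * w)\<^sup>2)) = Re (of_real N * (x * y))"
    by (rule arg_cong)
  then have "(1 + t) * Re (a * cnj b * (u * w)\<^sup>2) = N * Re (x * y)"
    by (simp only: times_complex.sel Re_complex_of_real Im_complex_of_real mult_zero_left diff_zero)
  also have "\<dots> \<ge> N * (- (t * (1 + t)))" using xy N by (intro mult_left_mono) auto
  finally have "(1 + t) * (- (t * N)) \<le> (1 + t) * Re (a * cnj b * (u * w)\<^sup>2)"
    by (simp add: algebra_simps)
  then have "- (t * N) \<le> Re (a * cnj b * (u * w)\<^sup>2)"
    by (rule mult_left_le_imp_le) (use t in simp)
  then show ?thesis using u(1) by (simp add: norm_mult t_def N_def)
qed simp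

text \<open>\<open>v\<close> is a boundary vector of the cone on the side where rotation by
  \<open>u\<close> leaves it. Only u^2 matters, since the cone is symmetric under negation.\<close>

lemma rotation_moves_double_cone:
  assumes ab: "(cmod a)\<^sup>2 - (cmod b)\<^sup>2 = 1" and b: "b \<noteq> 0" and u: "cmod u = 1" "u\<^sup>2 \<noteq> 1"
  obtains v where "cmod v = 1" "v \<in> double_cone a b" "u * v \<notin> double_cone a b"
proof -
  define t where "t = (cmod b)\<^sup>2"
  have t: "t > 0" and a: "(cmod a)\<^sup>2 = 1 + t" using b ab by (simp_all add: t_def)
  \<comment> \<open>The sign selects one of the two boundary lines so that the term with Im (u^2)
    cannot increase the form.\<close>
  define s where "s = (if Im (u\<^sup>2) \<ge> 0 then cmod b else - cmod b)"
  have s: "s\<^sup>2 = t" "s \<noteq> 0" "s * Im (u\<^sup>2) \<ge> 0" using b by (auto simp: s_def t_def mult_nonneg_nonpos)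
  define y where "y = Complex t s"
  \<comment> \<open>This gives cnj (a b) v^2 = y with Re y = t, that is, equality in the cone
    condition.\<close>
  define v where "v = csqrt (y / cnj (a * b))"
  have ab0: "cnj (a * b) \<noteq> 0" using b a t by auto
  have "(cmod y)\<^sup>2 = (cmod a * cmod b)\<^sup>2"
  proof -
    have "(cmod y)\<^sup>2 = t\<^sup>2 + t" using s(1) by (simp add: y_def cmod_power2)
    moreover have "(cmod a * cmod b)\<^sup>2 = (1 + t) * t"
      by (simp only: power_mult_distrib a flip: t_def)
    ultimately show ?thesis by (simp add: power2_eq_square algebra_simps)
  qed
  then have "cmod y = cmod (cnj (a * b))" by (simp add: norm_mult)
  then have "cmod (v\<^sup>2) = 1" using ab0 by (simp add: v_def norm_divide)
  then have v: "cmod v = 1" by (simp add: norm_power power2_eq_1_iff) (smt (verit) norm_ge_zero)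
  have y: "cnj (a * b) * v\<^sup>2 = y" using ab0 by (simp add: v_def)
  have u2: "Re (u\<^sup>2) \<le> 1"
    using complex_Re_le_cmod[of "u\<^sup>2"] u(1) by (simp add: norm_power del: Re_power2)
  have u2': "Re (u\<^sup>2) < 1" if "Im (u\<^sup>2) = 0"
    using u(2) u2 that by (auto simp: complex_eq_iff less_le simp del: Re_power2 Im_power2)
  have eq: "cnj (a * b) * (u * v)\<^sup>2 = u\<^sup>2 * y"
    unfolding y[symmetric] by (simp add: power_mult_distrib)
  have "Re (cnj (a * b) * (u * v)\<^sup>2) = t * Re (u\<^sup>2) - s * Im (u\<^sup>2)"
    unfolding eq y_def by simp
  also have "\<dots> < t"
  proof (cases "Im (u\<^sup>2) = 0")
    case True
    then show ?thesis using u2' t by simp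
  next
    case False
    then have "s * Im (u\<^sup>2) > 0" using s by (simp add: less_le)
    moreover have "t * Re (u\<^sup>2) \<le> t * 1" using u2 t by (intro mult_left_mono) auto
    ultimately show ?thesis by linarith
  qed
  finally have "u * v \<notin> double_cone a b" using u(1) v by (simp add: double_cone_def norm_mult t_def)
  moreover have "v \<in> double_cone a b" unfolding double_cone_def mem_Collect_eq y using v by (simp add: y_def t_def)
  ultimately show ?thesis using that v by blast
qed

section \<open>Finite order elliptic generators\<close>

lemma finite_moebius_preimage:
  assumes "finite H"
  shows "finite {A \<in> SL2. moebius A \<in> H}"
proof -
  have "finite {A \<in> SL2. moebius A = h}" for h
  proof (cases "\<exists>B\<in>SL2. moebius B = h")
    case True
    then obtain B where "B \<in> SL2" "moebius B = h" by blast
    then have "{A \<in> SL2. moebius A = h} \<subseteq> {B, - B}"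
      using moebius_eq_imp by (auto simp: SL2_def)
    then show ?thesis using finite_subset by blast
  qed (auto intro: finite_subset[of _ "{}"])
  then have "finite (\<Union>h\<in>H. {A \<in> SL2. moebius A = h})" using assms by blast
  moreover have "{A \<in> SL2. moebius A \<in> H} = (\<Union>h\<in>H. {A \<in> SL2. moebius A = h})" by blast
  ultimately show ?thesis by simp
qed

text \<open>A finite set has only finitely many matrices, so those other than \<open>mat 1\<close>
  keep a positive distance from it. It is applied with the powers of \<open>f\<close> as
  \<open>H\<close> and the words containing \<open>g\<close> inside \<open>T\<close>.\<close>

lemma semidiscrete_Un_finite:
  assumes "finite H" "S \<subseteq> H \<union> T" "e > 0"
    and far: "\<And>A. A \<in> SL2 \<Longrightarrow> moebius A \<in> T \<Longrightarrow> dist A (mat 1) \<ge> e"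
  shows "semidiscrete S"
proof -
  obtain d where d: "d > 0"
    "\<And>A. A \<in> SL2 \<Longrightarrow> moebius A \<in> H \<Longrightarrow> A \<noteq> mat 1 \<Longrightarrow> dist (mat 1) A \<ge> d"
    using finite_set_avoid[OF finite_moebius_preimage[OF assms(1)], of "mat 1"] by auto
  have "moebius A = id" if "A \<in> SL2" "moebius A \<in> S" "dist A (mat 1) < min d e" for A
  proof -
    have "moebius A \<in> H" using far[of A] that assms(2) by auto
    then have "A = mat 1" using d(2)[of A] that by (force simp: dist_commute)
    then show ?thesis by (simp add: moebius_mat1)
  qed
  then show ?thesis
    using d(1) assms(3) unfolding semidiscrete_iff by (intro exI[of _ "min d e"]) auto
qed

lemma pow_mod_ord:
  assumes "f \<in> carrier moebius_group"
  shows "f [^]\<^bsub>moebius_group\<^esub> (n mod group.ord moebius_group f) = f [^]\<^bsub>moebius_group\<^esub> n"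
proof -
  define m where "m = group.ord moebius_group f"
  have "f [^]\<^bsub>moebius_group\<^esub> (m * (n div m)) = id"
    using assms moebius.pow_ord_eq_1[of f]
    by (simp add: m_def moebius.nat_pow_one[simplified] flip: moebius.nat_pow_pow)
  then have "f [^]\<^bsub>moebius_group\<^esub> (m * (n div m) + n mod m) = f [^]\<^bsub>moebius_group\<^esub> (n mod m)"
    using moebius.nat_pow_mult[OF assms, of "m * (n div m)" "n mod m"] by simp
  then show ?thesis by (simp only: m_def mult_div_mod_eq)
qed

lemma semidiscrete_if_rotates_to_hyperbolic:
  assumes f: "f \<in> carrier moebius_group" and g: "g \<in> carrier moebius_group"
    and ne: "\<not> elementary (semigroup_generated {f, g})"
    and ell: "elliptic f" "finite_order f"
    and hyp: "\<And>n. n < group.ord moebius_group f \<Longrightarrow>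
      \<not> elliptic (f [^]\<^bsub>moebius_group\<^esub> n \<otimes>\<^bsub>moebius_group\<^esub> g)"
  shows "semidiscrete (semigroup_generated {f, g})"
proof -
  define m where "m = group.ord moebius_group f"
  have "m > 0"
    using ell(2) f moebius.pow_eq_id[of f] by (auto simp: finite_order_def m_def intro: Nat.gr0I)
  have hyp': "\<not> elliptic (f [^]\<^bsub>moebius_group\<^esub> n \<otimes>\<^bsub>moebius_group\<^esub> g)" for n :: nat
    using hyp[of "n mod m"] \<open>m > 0\<close> pow_mod_ord[OF f, of n] by (simp add: m_def)
  define H where "H = range (\<lambda>n::nat. f [^]\<^bsub>moebius_group\<^esub> n)"
  have "H \<subseteq> (\<lambda>n. f [^]\<^bsub>moebius_group\<^esub> n) ` {..<m}"
    unfolding H_def using \<open>m > 0\<close> pow_mod_ord[OF f]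
    by (metis (no_types, lifting) image_eqI image_subsetI lessThan_iff m_def mod_less_divisor)
  then have "finite H" using finite_surj by blast

  obtain z u where zu: "Im z > 0" "cmod u = 1" "f = moebius (rot z u)" "f \<noteq> id"
    using ell(1) by (rule ellipticE)
  then have z: "Im z \<noteq> 0" by simp
  have f_pow: "f [^]\<^bsub>moebius_group\<^esub> n = moebius (rot z (u ^ n))" for n :: nat
    using moebius_rot_pow[OF z zu(2)] zu(3) by simp
  have rot: "rot z (u ^ n) \<in> SL2" for n using rot_SL2[OF z] zu(2) by (simp add: norm_power)
  \<comment> \<open>The value -1 is excluded too, because \<open>- mat 1\<close> also acts as
    \<open>id\<close>.\<close>
  have u2: "u\<^sup>2 \<noteq> 1"
  proof
    assume "u\<^sup>2 = 1"
    then have "u = 1 \<or> u = - 1" by (simp add: power2_eq_1_iff)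
    moreover have "rot z (- 1) = - mat 1"
      by (rule mat2_eqI) (simp_all add: rot_def mat_def)
    ultimately show False using zu(3,4) by (auto simp: rot_1 moebius_mat1 moebius_uminus)
  qed

  obtain G where G: "G \<in> SL2" "g = moebius G" using g by (rule carrier_moebiusE)
  define a b where "a = disc_a z G" and "b = disc_b z G"
  have ab: "(cmod a)\<^sup>2 - (cmod b)\<^sup>2 = 1"
    using disc_norm[OF z, of G] G(1) by (simp add: a_def b_def SL2_def)
  \<comment> \<open>If b vanished, \<open>g\<close> would fix the fixed point \<open>z\<close> of
    \<open>f\<close>.\<close>
  have "b \<noteq> 0"
  proof
    assume "b = 0"
    then have "g (Some z) = Some z"
      using disc_b_eq_0_imp_fixed[OF zu(1) G(1)] G(2) by (simp add: b_def)
    moreover have "f (Some z) = Some z"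
      unfolding zu(3) using zu(1) rot[of 1] disc_rot(2)[OF z]
      by (intro disc_b_eq_0_imp_fixed) simp_all
    ultimately have "\<And>h. h \<in> {f, g} \<Longrightarrow> h (Some z) = Some z" by blast
    moreover have "Some z \<in> closed_upper_half_plane"
      using zu(1) by (simp add: closed_upper_half_plane_def upper_half_plane_def)
    ultimately show False using common_fixed_point_elementary ne by blast
  qed
  have trace: "\<bar>Re (u ^ n * a)\<bar> \<ge> 1" for n
  proof -
    have "f [^]\<^bsub>moebius_group\<^esub> n \<otimes>\<^bsub>moebius_group\<^esub> g = moebius (rot z (u ^ n) ** G)"
      using rot G by (simp add: f_pow moebius_mult)
    then have "\<bar>trace (rot z (u ^ n) ** G)\<bar> \<ge> 2"
      using hyp'[of n] elliptic_if_trace_less_2[OF SL2_mult[OF rot[of n] G(1)]] by fastforce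
    moreover have "trace (rot z (u ^ n) ** G) = 2 * Re (u ^ n * a)"
      unfolding disc_trace[OF z, symmetric] disc_mult[OF z] disc_rot[OF z] by (simp add: a_def)
    ultimately show ?thesis by linarith
  qed

  define C where "C n = (\<lambda>w. u ^ n * w) ` double_cone a b" for n
  have G_C: "disc_act z G w \<in> C 0" if "w \<in> C n" for n w
  proof -
    obtain w' where "w = u ^ n * w'" "w' \<in> double_cone a b" using \<open>w \<in> C n\<close> by (auto simp: C_def)
    then have "Re (a * cnj b * w\<^sup>2) \<ge> - ((cmod b)\<^sup>2 * (cmod w)\<^sup>2)"
      using rotated_double_cone_avoids[OF ab _ trace[of n]] zu(2) by (simp only: norm_power power_one)
    then have "a * w + b * cnj w \<in> double_cone a b" by (rule image_in_double_cone[OF ab])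
    then show ?thesis by (simp add: C_def disc_act_def a_def b_def)
  qed
  have rot_C: "disc_act z (rot z (u ^ k)) w \<in> C (k + n)" if "w \<in> C n" for k n w
    using that by (auto simp: C_def disc_act_rot[OF z] power_add mult.assoc)

  \<comment> \<open>The target index \<open>k\<close> does not depend on \<open>n\<close>, so
    \<open>T\<close> absorbs products with \<open>H\<close> on both sides and is closed under
    composition.\<close>
  define T where "T = {moebius A | A. A \<in> SL2 \<and> (\<exists>k. \<forall>n. \<forall>w\<in>C n. disc_act z A w \<in> C k)}"
  have T_I: "moebius A \<in> T" if "A \<in> SL2" "\<And>n w. w \<in> C n \<Longrightarrow> disc_act z A w \<in> C k" for A k
    unfolding T_def using that by blast
  have "h \<in> H \<union> T" if "h \<in> semigroup_generated {f, g}" for h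
    using that
  proof induction
    case (gen h)
    then consider "h = f" | "h = g" by auto
    then show ?case
    proof cases
      case 1
      then have "h = f [^]\<^bsub>moebius_group\<^esub> (1::nat)" using f by simp
      then show ?thesis unfolding H_def by blast
    next
      case 2
      then show ?thesis using G T_I[OF G(1), of 0] G_C by simp
    qed
  next
    case (mult h k)
    consider (HH) "h \<in> H" "k \<in> H" | (HT) "h \<in> H" "k \<in> T" | (TH) "h \<in> T" "k \<in> H" | (TT) "h \<in> T" "k \<in> T"
      using mult.IH by blast
    then show ?case
    proof cases
      case HH
      then show ?thesis using f by (auto simp: H_def moebius.nat_pow_mult)
    next
      case HT
      then obtain n A j where "h = f [^]\<^bsub>moebius_group\<^esub> (n::nat)" "A \<in> SL2" "k = moebius A"
        "\<And>n w. w \<in> C n \<Longrightarrow> disc_act z A w \<in> C j" unfolding H_def T_def by blast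
      moreover from this have "\<And>l w. w \<in> C l \<Longrightarrow> disc_act z (rot z (u ^ n) ** A) w \<in> C (n + j)"
        using rot_C by (simp add: disc_act_mult[OF z])
      ultimately show ?thesis
        using rot[of n] T_I[of "rot z (u ^ n) ** A" "n + j"] by (simp add: f_pow moebius_mult SL2_mult)
    next
      case TH
      then obtain n A j where "k = f [^]\<^bsub>moebius_group\<^esub> (n::nat)" "A \<in> SL2" "h = moebius A"
        "\<And>n w. w \<in> C n \<Longrightarrow> disc_act z A w \<in> C j" unfolding H_def T_def by blast
      moreover from this have "\<And>l w. w \<in> C l \<Longrightarrow> disc_act z (A ** rot z (u ^ n)) w \<in> C j"
        using rot_C unfolding disc_act_mult[OF z] by blast
      ultimately show ?thesis
        using rot[of n] T_I[of "A ** rot z (u ^ n)" j] by (simp add: f_pow moebius_mult SL2_mult)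
    next
      case TT
      then obtain A B i j where "h = moebius A" "A \<in> SL2" "k = moebius B" "B \<in> SL2"
        "\<And>n w. w \<in> C n \<Longrightarrow> disc_act z A w \<in> C i" "\<And>n w. w \<in> C n \<Longrightarrow> disc_act z B w \<in> C j"
        unfolding T_def by blast
      moreover from this have "\<And>l w. w \<in> C l \<Longrightarrow> disc_act z (A ** B) w \<in> C i"
        unfolding disc_act_mult[OF z] by blast
      ultimately show ?thesis
        using T_I[of "A ** B" i] by (simp add: moebius_mult SL2_mult)
    qed
  qed
  then have subset: "semigroup_generated {f, g} \<subseteq> H \<union> T" by blast

  obtain v where v: "cmod v = 1" "v \<in> double_cone a b" "u * v \<notin> double_cone a b"
    using rotation_moves_double_cone[OF ab \<open>b \<noteq> 0\<close> zu(2) u2] .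
  have "open (- double_cone a b)"
    unfolding double_cone_def open_closed double_complement
    by (intro closed_Collect_le continuous_intros)
  then obtain e where e: "e > 0" "\<And>w. dist w (u * v) < e \<Longrightarrow> w \<notin> double_cone a b"
    using v(3) unfolding open_dist by (metis ComplD ComplI)
  obtain d where d: "d > 0"
    "\<And>A w. dist A (mat 1) < d \<Longrightarrow> cmod w = 1 \<Longrightarrow> dist (disc_act z A w) w < e"
    using disc_act_near_id[OF z e(1)] by blast
  have far: "dist A (mat 1) \<ge> d" if A: "A \<in> SL2" "moebius A \<in> T" for A
  proof (rule ccontr)
    assume near: "\<not> dist A (mat 1) \<ge> d"
    obtain B k where B: "B \<in> SL2" "moebius A = moebius B" "\<And>n w. w \<in> C n \<Longrightarrow> disc_act z B w \<in> C k"
      using A(2) unfolding T_def by blast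
    \<comment> \<open>\<open>k\<close> varies with the word, so the test vector is rotated along:
      \<open>A\<close> sends \<open>x\<close> into \<open>C k\<close>, while \<open>x\<close> is u^k
      times \<open>u * v\<close>, which lies outside the cone. Undoing u^k preserves distances, so
      one margin \<open>e\<close> serves all words.\<close>
    define x where "x = u ^ Suc k * v"
    have "x \<in> C (Suc k)" unfolding C_def x_def by (intro imageI v(2))
    then have "disc_act z B x \<in> C k" by (rule B(3))
    moreover have "A = B \<or> A = - B" using moebius_eq_imp A(1) B(1,2) by (simp add: SL2_def)
    moreover have "disc_act z (- B) x = - disc_act z B x" by (rule disc_act_uminus)
    moreover have "- w \<in> C k" if "w \<in> C k" for w
      using that uminus_in_double_cone[of _ a b] by (auto simp: C_def image_iff) (metis mult_minus_right)
    ultimately have "disc_act z A x \<in> C k" by metis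
    then obtain w where w: "disc_act z A x = u ^ k * w" "w \<in> double_cone a b" by (auto simp: C_def)
    have "dist (u ^ k * w) (u ^ k * (u * v)) = dist w (u * v)"
      using zu(2) by (simp add: dist_norm norm_mult norm_power flip: right_diff_distrib)
    moreover have "dist (disc_act z A x) x < e"
      using d(2)[of A x] near zu(2) v(1) by (simp add: x_def norm_mult norm_power)
    moreover have "x = u ^ k * (u * v)" by (simp add: x_def)
    ultimately have "dist w (u * v) < e" by (metis w(1))
    then show False using e(2) w(2) by blast
  qed
  show ?thesis
    by (rule semidiscrete_Un_finite[OF \<open>finite H\<close> subset d(1)]) (rule far)
qed

theorem theorem1p6:
  fixes f g :: "sphere \<Rightarrow> sphere"
  assumes "f \<in> carrier moebius_group"
    and "g \<in> carrier moebius_group"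
    and "moebius_tr f \<le> moebius_tr g"
    and "\<not> elementary (semigroup_generated {f, g})"
  shows "semidiscrete (semigroup_generated {f, g}) \<longleftrightarrow>
    (semidiscrete (semigroup_generated {f, g}) \<and> inverse_free (semigroup_generated {f, g}))
    \<or> fuchsian_group (semigroup_generated {f, g})
    \<or> (elliptic f \<and> finite_order f \<and>
        (\<forall>n \<in> {0..<group.ord moebius_group f}.
           \<not> elliptic (f [^]\<^bsub>moebius_group\<^esub> n \<otimes>\<^bsub>moebius_group\<^esub> g)))"
  using semidiscrete_trichotomy[OF assms] fuchsian_imp_semidiscrete
    semidiscrete_if_rotates_to_hyperbolic[OF assms(1,2,4)]
  by (metis atLeastLessThan_iff le0)

end
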